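(* Let $H$ be a Cohen--Macaulay very well-covered graph with $2d_0$ vertices $V(H)=\{x'_1,\ldots,x'_{d_0}\}\cup\{y'_1,\ldots,y'_{d_0}\}$ such that $\{x'_1,\ldots,x'_{d_0}\}$ is a minimal vertex cover of $H$, $\{y'_1,\ldots,y'_{d_0}\}$ is a maximal independent set of $H$, $\{x'_i,y'_i\}\in E(H)$ for all $i$, and $\{x'_i,y'_j\}\in E(H)$ implies $i\le j$. Let $n_1,\ldots,n_{d_0}$ be positive integers, let $G=H(n_1,\ldots,n_{d_0})$ be the very well-covered graph on the vertices $x_{i,k},y_{i,k}$ ($1\le i\le d_0$, $1\le k\le n_i$) obtained from $H$ by replacing each edge $\{x'_i,y'_i\}$ with the complete bipartite graph $K_{n_i,n_i}$, and let $S=\Bbbk[V(G)]$. In $S$ interpret $x'_i$ as the monomial $x_{i,1}\cdots x_{i,n_i}$ and $y'_i$ as the monomial $y_{i,1}\cdots y_{i,n_i}$. For a minimal vertex cover $C$ of $H$ put $$\mathcal{C}(H;C)=\{x'_s : y'_s\in C\ \text{and}\ (C\setminus\{y'_s\})\cup\{x'_s\}\in\mathrm{Min}(H)\}.$$ For $p\ge0$ let $F_p$ be the free $S$-module with basis the symbols $\mathbf{f}(C;\sigma)$ of multidegree $\mathbf{z}_C\mathbf{x}'_\sigma$, where $C\in\mathrm{Min}(H)$ and $\sigma\subseteq\mathcal{C}(H;C)$ with $|\sigma|=p$. Let $d_0:F_0\to J(G)$ be given by $\mathbf{f}(C;\emptyset)\mapsto\mathbf{z}_C$, and for $p>0$ let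 $d_p:F_p\to F_{p-1}$ be given by $$d_p(\mathbf{f}(C;\sigma))=\sum_{x'_s\in\sigma}(-1)^{\alpha(\sigma;x'_s)}\Big[y'_s\,\mathbf{f}\big((C\setminus\{y'_s\})\cup\{x'_s\};\sigma\setminus\{x'_s\}\big)-x'_s\,\mathbf{f}\big(C;\sigma\setminus\{x'_s\}\big)\Big],$$ where $\alpha(\sigma;x'_s)=|\{x'_j\in\sigma : j>s\}|$. Then $$\mathbb{F}:\cdots\to F_p\xrightarrow{d_p}F_{p-1}\to\cdots\xrightarrow{d_1}F_0\xrightarrow{d_0}J(G)\to0$$ is a minimal free resolution of the cover ideal $J(G)$.
   Context: Graphs are finite simple graphs; $\Bbbk$ is an arbitrary field. A graph is very well-covered if it has no isolated vertices and all its minimal vertex covers have the same cardinality, equal to half the number of its vertices. A graph $\Gamma$ is Cohen--Macaulay if $\Bbbk[V(\Gamma)]/I(\Gamma)$ is Cohen--Macaulay, where the edge ideal $I(\Gamma)$ is generated by $uv$, $\{u,v\}\in E(\Gamma)$. $H(n_1,\ldots,n_{d_0})$ has vertex set $\bigcup_{i=1}^{d_0}(\{x_{i,1},\ldots,x_{i,n_i}\}\cup\{y_{i,1},\ldots,y_{i,n_i}\})$; here each vertex $x'_i$ (resp. $y'_i$) of $H$ is replaced by the $n_i$ pairwise non-adjacent copies $x_{i,1},\ldots,x_{i,n_i}$ (resp. $y_{i,1},\ldots,y_{i,n_i}$), and a copy of $u$ is adjacent to a copy of $v$ if and only if $\{u,v\}\in E(H)$. (Every very well-covered graph is isomorphic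 to some $H(n_1,\ldots,n_{d_0})$ with $H$ as in the claim, by a known theorem.) $\mathrm{Min}(H)$ is the set of inclusion-minimal vertex covers of $H$. The cover ideal $J(G)\subseteq\Bbbk[V(G)]$ is generated by the monomials $\prod_{v\in C}v$, $C$ a vertex cover of $G$. For $C\subseteq V(H)$, $\mathbf{z}_C$ is the product in $S$ of the monomials $x'_i$ ($x'_i\in C$) and $y'_i$ ($y'_i\in C$); $\mathbf{x}'_\sigma=\prod_{x'_s\in\sigma}x'_s$. The letter $d_0$ denotes both the integer $\tfrac12|V(H)|$ and the augmentation map; no confusion arises. *)

theory Defs
  imports
    "HOL-Library.Poly_Mapping"
    "HOL-Library.Extended_Nat"
    "HOL-Algebra.QuotRing"
    "HOL-Algebra.Module"
    "HOL-Algebra.Ring_Divisibility"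
begin

section \<open>Polynomial rings\<close>

text \<open>
  Monomials are exponent vectors, and polynomials with variables in the type \<open>'v\<close> are finitely
  supported functions from monomials to coefficients.  The ring \<open>k[V]\<close> consists of those
  polynomials that involve only variables from the set \<open>V\<close>.
\<close>

type_synonym 'v monomial = "'v \<Rightarrow>\<^sub>0 nat"
type_synonym ('v, 'k) mpoly = "'v monomial \<Rightarrow>\<^sub>0 'k"

definition mpoly_ring :: "'v set \<Rightarrow> ('v, 'k::field) mpoly ring" where
  "mpoly_ring V = \<lparr>carrier = {p. \<forall>e \<in> Poly_Mapping.keys p. Poly_Mapping.keys e \<subseteq> V},
     mult = (*), one = 1, zero = 0, add = (+)\<rparr>"

definition Var :: "'v \<Rightarrow> ('v, 'k::field) mpoly" where
  "Var v = Poly_Mapping.single (Poly_Mapping.single v 1) 1"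

definition irrelevant_ideal :: "'v set \<Rightarrow> ('v, 'k::field) mpoly set" where
  "irrelevant_ideal V = genideal (mpoly_ring V) (Var ` V)"


section \<open>Cohen--Macaulay rings\<close>

text \<open>
  A Noetherian commutative ring is Cohen--Macaulay if \<open>depth(\<mm>) = height(\<mm>)\<close> for every maximal
  ideal \<open>\<mm>\<close>, where the depth of an ideal is the maximal length of a regular sequence inside it.
  As \<open>depth(\<mm>) = depth(R\<^sub>\<mm>)\<close> and \<open>height(\<mm>) = dim(R\<^sub>\<mm>)\<close>, this is the usual condition on the
  localizations at the maximal ideals.
\<close>

definition regular_sequence :: "('a, 'm) ring_scheme \<Rightarrow> 'a list \<Rightarrow> bool" where
  "regular_sequence R as \<longleftrightarrow>
     set as \<subseteq> carrier R \<and>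
     genideal R (set as) \<noteq> carrier R \<and>
     (\<forall>i < length as. \<forall>r \<in> carrier R.
        as ! i \<otimes>\<^bsub>R\<^esub> r \<in> genideal R (set (take i as)) \<longrightarrow> r \<in> genideal R (set (take i as)))"

definition ideal_depth :: "('a, 'm) ring_scheme \<Rightarrow> 'a set \<Rightarrow> enat" where
  "ideal_depth R I = Sup {enat (length as) | as. set as \<subseteq> I \<and> regular_sequence R as}"

definition prime_height :: "('a, 'm) ring_scheme \<Rightarrow> 'a set \<Rightarrow> enat" where
  "prime_height R P = Sup {enat l | l. \<exists>Q :: nat \<Rightarrow> 'a set.
     (\<forall>i \<le> l. primeideal (Q i) R) \<and> (\<forall>i < l. Q i \<subset> Q (Suc i)) \<and> Q l = P}"

definition cohen_macaulay_ring :: "('a, 'm) ring_scheme \<Rightarrow> bool" where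
  "cohen_macaulay_ring R \<longleftrightarrow>
     cring R \<and> noetherian_ring R \<and>
     (\<forall>M. maximalideal M R \<longrightarrow> ideal_depth R M = prime_height R M)"


section \<open>Graphs and their ideals\<close>

definition simple_graph :: "'v set \<Rightarrow> 'v set set \<Rightarrow> bool" where
  "simple_graph V E \<longleftrightarrow> finite V \<and> (\<forall>e \<in> E. e \<subseteq> V \<and> card e = 2)"

definition independent_set :: "'v set \<Rightarrow> 'v set set \<Rightarrow> 'v set \<Rightarrow> bool" where
  "independent_set V E A \<longleftrightarrow> A \<subseteq> V \<and> (\<forall>e \<in> E. \<not> e \<subseteq> A)"

definition maximal_independent_set :: "'v set \<Rightarrow> 'v set set \<Rightarrow> 'v set \<Rightarrow> bool" where
  "maximal_independent_set V E A \<longleftrightarrow>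
     independent_set V E A \<and> (\<forall>B. independent_set V E B \<and> A \<subseteq> B \<longrightarrow> B = A)"

definition vertex_cover :: "'v set \<Rightarrow> 'v set set \<Rightarrow> 'v set \<Rightarrow> bool" where
  "vertex_cover V E C \<longleftrightarrow> C \<subseteq> V \<and> (\<forall>e \<in> E. e \<inter> C \<noteq> {})"

definition Min_covers :: "'v set \<Rightarrow> 'v set set \<Rightarrow> 'v set set" where
  "Min_covers V E = {C. vertex_cover V E C \<and> (\<forall>D. vertex_cover V E D \<and> D \<subseteq> C \<longrightarrow> D = C)}"

definition very_well_covered :: "'v set \<Rightarrow> 'v set set \<Rightarrow> bool" where
  "very_well_covered V E \<longleftrightarrow>
     (\<forall>v \<in> V. \<exists>e \<in> E. v \<in> e) \<and> (\<forall>C \<in> Min_covers V E. 2 * card C = card V)"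

definition edge_ideal :: "'v set \<Rightarrow> 'v set set \<Rightarrow> ('v, 'k::field) mpoly set" where
  "edge_ideal V E = genideal (mpoly_ring V) {Var u * Var v | u v. {u, v} \<in> E}"

definition cover_ideal :: "'v set \<Rightarrow> 'v set set \<Rightarrow> ('v, 'k::field) mpoly set" where
  "cover_ideal V E = genideal (mpoly_ring V) {\<Prod>v\<in>C. Var v | C. vertex_cover V E C}"

definition cohen_macaulay_graph :: "'k::field itself \<Rightarrow> 'v set \<Rightarrow> 'v set set \<Rightarrow> bool" where
  "cohen_macaulay_graph k V E \<longleftrightarrow>
     cohen_macaulay_ring (mpoly_ring V Quot (edge_ideal V E :: ('v, 'k) mpoly set))"


section \<open>Free modules and minimal free resolutions\<close>

text \<open>
  The free \<open>R\<close>-module with basis \<open>B\<close> consists of the finitely supported coordinate functions.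
  The fields \<open>mult\<close> and \<open>one\<close> of a module record carry no meaning.
\<close>

definition free_module :: "('a, 'm) ring_scheme \<Rightarrow> 'b set \<Rightarrow> ('a, 'b \<Rightarrow> 'a) module" where
  "free_module R B =
     \<lparr>carrier = {f. (\<forall>b. f b \<in> carrier R) \<and> (\<forall>b. b \<notin> B \<longrightarrow> f b = \<zero>\<^bsub>R\<^esub>) \<and> finite {b. f b \<noteq> \<zero>\<^bsub>R\<^esub>}},
      mult = undefined, one = undefined,
      zero = (\<lambda>b. \<zero>\<^bsub>R\<^esub>), add = (\<lambda>f g b. f b \<oplus>\<^bsub>R\<^esub> g b),
      smult = (\<lambda>r f b. r \<otimes>\<^bsub>R\<^esub> f b)\<rparr>"

definition ideal_as_module :: "('a, 'm) ring_scheme \<Rightarrow> 'a set \<Rightarrow> ('a, 'a) module" where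
  "ideal_as_module R I =
     \<lparr>carrier = I, mult = undefined, one = undefined,
      zero = \<zero>\<^bsub>R\<^esub>, add = add R, smult = mult R\<rparr>"

definition linear_map ::
    "('a, 'm) ring_scheme \<Rightarrow> ('a, 'b) module \<Rightarrow> ('a, 'c) module \<Rightarrow> ('b \<Rightarrow> 'c) \<Rightarrow> bool" where
  "linear_map R M N f \<longleftrightarrow>
     f \<in> carrier M \<rightarrow> carrier N \<and>
     (\<forall>u \<in> carrier M. \<forall>v \<in> carrier M. f (u \<oplus>\<^bsub>M\<^esub> v) = f u \<oplus>\<^bsub>N\<^esub> f v) \<and>
     (\<forall>r \<in> carrier R. \<forall>u \<in> carrier M. f (r \<odot>\<^bsub>M\<^esub> u) = r \<odot>\<^bsub>N\<^esub> f u)"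

definition map_kernel :: "('a, 'b) module \<Rightarrow> ('a, 'c) module \<Rightarrow> ('b \<Rightarrow> 'c) \<Rightarrow> 'b set" where
  "map_kernel M N f = {u \<in> carrier M. f u = \<zero>\<^bsub>N\<^esub>}"

definition ideal_times_module :: "('a, 'm) ring_scheme \<Rightarrow> 'a set \<Rightarrow> ('a, 'b) module \<Rightarrow> 'b set" where
  "ideal_times_module R I M =
     \<Inter> {N. submodule N R M \<and> (\<forall>r \<in> I. \<forall>u \<in> carrier M. r \<odot>\<^bsub>M\<^esub> u \<in> N)}"

text \<open>
  \<open>k[V]\<close> is graded by exponent vectors.  If the basis element \<open>b\<close> is given the multidegree
  \<open>mdeg b\<close>, an element of the free module is homogeneous of multidegree \<open>m\<close> if each of its
  coordinates at \<open>b\<close> is a scalar multiple of a monomial \<open>e\<close> with \<open>e + mdeg b = m\<close>.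
\<close>

definition free_component ::
    "'v set \<Rightarrow> 'b set \<Rightarrow> ('b \<Rightarrow> 'v monomial) \<Rightarrow> 'v monomial \<Rightarrow> ('b \<Rightarrow> ('v, 'k::field) mpoly) set" where
  "free_component V B mdeg m =
     {f \<in> carrier (free_module (mpoly_ring V) B).
        \<forall>b \<in> B. \<forall>e \<in> Poly_Mapping.keys (f b). e + mdeg b = m}"

definition ideal_component :: "('v, 'k::field) mpoly set \<Rightarrow> 'v monomial \<Rightarrow> ('v, 'k) mpoly set" where
  "ideal_component J m = {p \<in> J. Poly_Mapping.keys p \<subseteq> {m}}"

text \<open>
  For a family of finite bases \<open>B p\<close> of prescribed multidegrees, and with \<open>F p\<close> the free
  \<open>k[V]\<close>-module on \<open>B p\<close>, the predicate says that
  \<open>\<dots> \<rightarrow> F 1 \<rightarrow> F 0 \<rightarrow> J \<rightarrow> 0\<close> is a minimal multigraded free resolution of the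
  ideal \<open>J\<close>; here \<open>d p\<close> is the map from \<open>F p\<close> to \<open>F (p - 1)\<close> for \<open>p > 0\<close> (the value \<open>d 0\<close> is
  not used) and \<open>aug\<close> is the map from \<open>F 0\<close> to \<open>J\<close>.  The last four groups of conditions are:
  well-defined linear maps, degree preservation, exactness, and minimality
  \<open>d p (F p) \<subseteq> \<mm> F (p - 1)\<close>.
\<close>

definition minimal_free_resolution ::
    "'v set \<Rightarrow> (nat \<Rightarrow> 'b set) \<Rightarrow> ('b \<Rightarrow> 'v monomial) \<Rightarrow>
     (nat \<Rightarrow> ('b \<Rightarrow> ('v, 'k::field) mpoly) \<Rightarrow> ('b \<Rightarrow> ('v, 'k) mpoly)) \<Rightarrow>
     (('b \<Rightarrow> ('v, 'k) mpoly) \<Rightarrow> ('v, 'k) mpoly) \<Rightarrow> ('v, 'k) mpoly set \<Rightarrow> bool" where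
  "minimal_free_resolution V B mdeg d aug J \<longleftrightarrow>
     (let S = mpoly_ring V :: ('v, 'k) mpoly ring;
          F = (\<lambda>p. free_module S (B p));
          J_mod = ideal_as_module S J
      in ideal J S \<and>
         (\<forall>p. finite (B p)) \<and>

         linear_map S (F 0) J_mod aug \<and>
         (\<forall>p. linear_map S (F (Suc p)) (F p) (d (Suc p))) \<and>

         (\<forall>m. aug ` free_component V (B 0) mdeg m \<subseteq> ideal_component J m) \<and>
         (\<forall>p m. d (Suc p) ` free_component V (B (Suc p)) mdeg m \<subseteq> free_component V (B p) mdeg m) \<and>

         aug ` carrier (F 0) = J \<and>
         d 1 ` carrier (F 1) = map_kernel (F 0) J_mod aug \<and>
         (\<forall>p. d (Suc (Suc p)) ` carrier (F (Suc (Suc p))) = map_kernel (F (Suc p)) (F p) (d (Suc p))) \<and>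

         (\<forall>p. d (Suc p) ` carrier (F (Suc p)) \<subseteq> ideal_times_module S (irrelevant_ideal V) (F p)))"


section \<open>The graph \<open>H(n\<^sub>1, \<dots>, n\<^sub>d)\<close>\<close>

text \<open>
  The vertices of \<open>H\<close> are enumerated by \<open>x, y\<close> on \<open>{1..d}\<close>.  The \<open>k\<close>-th copy of a vertex \<open>v\<close> of \<open>H\<close>
  is the pair \<open>(v, k)\<close>; thus \<open>x\<^sub>i\<^sub>,\<^sub>k = (x i, k)\<close> and \<open>y\<^sub>i\<^sub>,\<^sub>k = (y i, k)\<close>.
\<close>

definition expansion_vertices ::
    "nat \<Rightarrow> (nat \<Rightarrow> 'v) \<Rightarrow> (nat \<Rightarrow> 'v) \<Rightarrow> (nat \<Rightarrow> nat) \<Rightarrow> ('v \<times> nat) set" where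
  "expansion_vertices d x y n =
     (\<Union>i\<in>{1..d}. {(x i, k) | k. 1 \<le> k \<and> k \<le> n i} \<union> {(y i, k) | k. 1 \<le> k \<and> k \<le> n i})"

definition expansion_edges :: "('v \<times> nat) set \<Rightarrow> 'v set set \<Rightarrow> ('v \<times> nat) set set" where
  "expansion_edges W E = {{a, b} | a b. a \<in> W \<and> b \<in> W \<and> {fst a, fst b} \<in> E}"

text \<open>
  A vertex \<open>v\<close> of \<open>H\<close> is interpreted in \<open>k[V(G)]\<close> as the product of its copies.  Below,
  \<open>W\<close> stands for the vertex set of \<open>G\<close>.
\<close>

definition copies_exponent :: "('v \<times> nat) set \<Rightarrow> 'v \<Rightarrow> ('v \<times> nat) monomial" where
  "copies_exponent W v = (\<Sum>w \<in> {w \<in> W. fst w = v}. Poly_Mapping.single w 1)"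

definition copies_product :: "('v \<times> nat) set \<Rightarrow> 'v \<Rightarrow> ('v \<times> nat, 'k::field) mpoly" where
  "copies_product W v = (\<Prod>w \<in> {w \<in> W. fst w = v}. Var w)"

definition z_monomial :: "('v \<times> nat) set \<Rightarrow> 'v set \<Rightarrow> ('v \<times> nat, 'k::field) mpoly" where
  "z_monomial W C = (\<Prod>v\<in>C. copies_product W v)"


section \<open>The complex\<close>

text \<open>
  \<open>swap_set\<close> is \<open>\<C>(H;C)\<close>, and the basis symbol \<open>\<^bold>f(C;\<sigma>)\<close> is encoded by the pair \<open>(C, \<sigma>)\<close>.
\<close>

definition swap_set ::
    "'v set \<Rightarrow> 'v set set \<Rightarrow> nat \<Rightarrow> (nat \<Rightarrow> 'v) \<Rightarrow> (nat \<Rightarrow> 'v) \<Rightarrow> 'v set \<Rightarrow> 'v set" where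
  "swap_set V E d x y C =
     {x s | s. s \<in> {1..d} \<and> y s \<in> C \<and> (C - {y s}) \<union> {x s} \<in> Min_covers V E}"

definition res_basis ::
    "'v set \<Rightarrow> 'v set set \<Rightarrow> nat \<Rightarrow> (nat \<Rightarrow> 'v) \<Rightarrow> (nat \<Rightarrow> 'v) \<Rightarrow> nat \<Rightarrow> ('v set \<times> 'v set) set" where
  "res_basis V E d x y p =
     {(C, \<sigma>). C \<in> Min_covers V E \<and> \<sigma> \<subseteq> swap_set V E d x y C \<and> card \<sigma> = p}"

text \<open>The exponent vector of the monomial \<open>\<^bold>z\<^sub>C \<^bold>x'\<^sub>\<sigma>\<close>.\<close>

definition res_degree :: "('v \<times> nat) set \<Rightarrow> 'v set \<times> 'v set \<Rightarrow> ('v \<times> nat) monomial" where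
  "res_degree W = (\<lambda>(C, \<sigma>). (\<Sum>v\<in>C. copies_exponent W v) + (\<Sum>v\<in>\<sigma>. copies_exponent W v))"

text \<open>The basis element \<open>\<^bold>f(C;\<sigma>)\<close> as a coordinate function.\<close>

definition res_symbol ::
    "'v set \<Rightarrow> 'v set \<Rightarrow> 'v set \<times> 'v set \<Rightarrow> ('v \<times> nat, 'k::field) mpoly" where
  "res_symbol C \<sigma> = (\<lambda>c. if c = (C, \<sigma>) then 1 else 0)"

definition alpha :: "nat \<Rightarrow> (nat \<Rightarrow> 'v) \<Rightarrow> 'v set \<Rightarrow> nat \<Rightarrow> nat" where
  "alpha d x \<sigma> s = card {x j | j. j \<in> {1..d} \<and> x j \<in> \<sigma> \<and> j > s}"

definition res_diff_symbol ::
    "('v \<times> nat) set \<Rightarrow> nat \<Rightarrow> (nat \<Rightarrow> 'v) \<Rightarrow> (nat \<Rightarrow> 'v) \<Rightarrow> 'v set \<times> 'v set \<Rightarrow>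
     ('v set \<times> 'v set \<Rightarrow> ('v \<times> nat, 'k::field) mpoly)" where
  "res_diff_symbol W d x y = (\<lambda>(C, \<sigma>) c.
     \<Sum>s \<in> {s \<in> {1..d}. x s \<in> \<sigma>}. (- 1) ^ alpha d x \<sigma> s *
       (copies_product W (y s) * res_symbol ((C - {y s}) \<union> {x s}) (\<sigma> - {x s}) c
        - copies_product W (x s) * res_symbol C (\<sigma> - {x s}) c))"

text \<open>Extension by linearity from the bases.\<close>

definition res_diff ::
    "'v set \<Rightarrow> 'v set set \<Rightarrow> ('v \<times> nat) set \<Rightarrow> nat \<Rightarrow> (nat \<Rightarrow> 'v) \<Rightarrow> (nat \<Rightarrow> 'v) \<Rightarrow> nat \<Rightarrow>
     ('v set \<times> 'v set \<Rightarrow> ('v \<times> nat, 'k::field) mpoly) \<Rightarrow>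
     ('v set \<times> 'v set \<Rightarrow> ('v \<times> nat, 'k) mpoly)" where
  "res_diff V E W d x y p f =
     (\<lambda>c. \<Sum>b \<in> res_basis V E d x y p. f b * res_diff_symbol W d x y b c)"

definition res_aug ::
    "'v set \<Rightarrow> 'v set set \<Rightarrow> ('v \<times> nat) set \<Rightarrow> nat \<Rightarrow> (nat \<Rightarrow> 'v) \<Rightarrow> (nat \<Rightarrow> 'v) \<Rightarrow>
     ('v set \<times> 'v set \<Rightarrow> ('v \<times> nat, 'k::field) mpoly) \<Rightarrow> ('v \<times> nat, 'k) mpoly" where
  "res_aug V E W d x y f = (\<Sum>b \<in> res_basis V E d x y 0. f b * z_monomial W (fst b))"

end

theory Submission
  imports Defs
begin

text \<open>
  A minimal vertex cover of \<open>H\<close> has \<open>d\<close> elements and meets all \<open>d\<close> edges \<open>{x'\<^sub>i, y'\<^sub>i}\<close>, so it contains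
  exactly one end of each; it is determined by the set \<open>D\<close> of the indices \<open>i\<close> with \<open>y'\<^sub>i \<in> C\<close>.  The sets
  \<open>D\<close> that arise are those containing no edge \<open>{x'\<^sub>i, x'\<^sub>j}\<close> and closed under \<open>i \<mapsto> j\<close> for the edges
  \<open>{x'\<^sub>i, y'\<^sub>j}\<close> (\<open>cover_sets_iff\<close>, \<open>Min_covers_eq\<close>).  They are closed under intersection, so
  indices that can be removed from \<open>D\<close> individually can be removed together.  This makes \<open>\<bbbF>\<close> well
  defined, and it is a complex because its differential is a sum of commuting operators with
  anticommuting signs (\<open>boundary_boundary\<close>).

  Exactness comes from the filtration by the size of \<open>D\<close>.  The term \<open>y'\<^sub>s \<^bold>f(\<dots>)\<close> of the differential
  replaces \<open>D\<close> by \<open>D - {s}\<close>, so on the graded pieces only the terms \<open>- x'\<^sub>s \<^bold>f(C; \<dots>)\<close> survive: the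
  piece at \<open>D\<close> is a Koszul complex on the monomials \<open>x'\<^sub>s\<close>, \<open>s\<close> removable from \<open>D\<close>.  These monomials
  involve disjoint sets of variables, so they form a regular sequence and the Koszul complex is
  exact in positive degrees (\<open>koszul_exact\<close>, \<open>weakly_regular_monomials\<close>).  A cycle of \<open>\<bbbF>\<close> of positive
  degree is therefore reduced to zero by subtracting boundaries, starting at the largest \<open>D\<close>
  (\<open>filtration_lifting\<close>).  In degree 0 the same reduction needs that the coefficient at the largest \<open>D\<close>
  in a relation among the \<open>\<^bold>z\<^sub>C\<close> lies in the ideal of the removable \<open>x'\<^sub>s\<close> (\<open>colon\<close>).  This follows from the
  ordering of the vertices: if \<open>D\<close> is not contained in \<open>D'\<close>, the least element of \<open>D - D'\<close> is removable
  from \<open>D\<close> (\<open>exists_removable\<close>).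

  The augmentation is onto because each vertex cover of \<open>G\<close> contains all copies of the vertices of some
  minimal vertex cover of \<open>H\<close> (\<open>J_eq\<close>), and minimality is clear, as the matrix entries of the
  differential are \<open>\<plusminus> x'\<^sub>s\<close> and \<open>\<plusminus> y'\<^sub>s\<close>, which are nonconstant monomials.
\<close>

section \<open>Koszul complexes\<close>

text \<open>The sign \<open>(-1)\<^sup>\<alpha>\<close> with \<open>\<alpha>\<close> the number of elements of \<open>\<tau>\<close> above \<open>s\<close>; it does not depend on
  whether \<open>s\<close> belongs to \<open>\<tau>\<close>.\<close>

definition exchange_sign :: "nat set \<Rightarrow> nat \<Rightarrow> 'r::comm_ring_1" where
  "exchange_sign \<tau> s = (- 1) ^ card {j \<in> \<tau>. s < j}"

lemma exchange_sign_insert: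
  assumes "finite \<tau>" "t \<notin> \<tau>"
  shows "exchange_sign (insert t \<tau>) s = (if s < t then - exchange_sign \<tau> s else exchange_sign \<tau> s)"
proof (cases "s < t")
  case True
  then have "{j \<in> insert t \<tau>. s < j} = insert t {j \<in> \<tau>. s < j}" by auto
  moreover have "t \<notin> {j \<in> \<tau>. s < j}" "finite {j \<in> \<tau>. s < j}" using assms by auto
  ultimately show ?thesis using True by (simp add: exchange_sign_def)
next
  case False
  then have "{j \<in> insert t \<tau>. s < j} = {j \<in> \<tau>. s < j}" by auto
  then show ?thesis using False by (simp add: exchange_sign_def)
qed

lemma exchange_sign_anticommute:
  assumes "finite \<tau>" "s \<notin> \<tau>" "t \<notin> \<tau>" "s \<noteq> t"
  shows "exchange_sign \<tau> s * exchange_sign (insert s \<tau>) t =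
     - (exchange_sign \<tau> t * exchange_sign (insert t \<tau>) s)"
  using assms by (auto simp: exchange_sign_insert)

text \<open>Vanishing on the diagonal is a separate hypothesis, because antisymmetry does not give it in
  characteristic two.\<close>

lemma sum_alternating_eq_0:
  fixes g :: "'a \<Rightarrow> 'a \<Rightarrow> 'b::ab_group_add"
  assumes "finite A" "\<And>s. s \<in> A \<Longrightarrow> g s s = 0"
    and "\<And>s t. s \<in> A \<Longrightarrow> t \<in> A \<Longrightarrow> s \<noteq> t \<Longrightarrow> g s t = - g t s"
  shows "(\<Sum>s\<in>A. \<Sum>t\<in>A. g s t) = 0"
  using assms
proof (induction A rule: finite_induct)
  case empty
  show ?case by simp
next
  case (insert a A)
  have "(\<Sum>s\<in>A. g s a) = (\<Sum>s\<in>A. - g a s)"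
    using insert.hyps by (intro sum.cong refl insert.prems(2)) auto
  moreover have "(\<Sum>s\<in>A. \<Sum>t\<in>A. g s t) = 0"
    by (intro insert.IH insert.prems) auto
  ultimately show ?case
    using insert.hyps insert.prems(1)[of a] by (simp add: sum.distrib sum_negf)
qed

text \<open>The Koszul differential of the elements \<open>X s\<close>, \<open>s \<in> T\<close>.  A chain is the function that sends a set
  \<open>\<sigma> \<subseteq> T\<close> to the coefficient of the corresponding basis element; chains of degree \<open>p\<close> are not given a
  type of their own, only their values on sets of size \<open>p\<close> are looked at.\<close>

definition koszul_diff :: "(nat \<Rightarrow> 'r::comm_ring_1) \<Rightarrow> nat set \<Rightarrow> (nat set \<Rightarrow> 'r) \<Rightarrow> nat set \<Rightarrow> 'r" where
  "koszul_diff X T w \<tau> = (\<Sum>s\<in>T - \<tau>. exchange_sign \<tau> s * (X s * w (insert s \<tau>)))"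

text \<open>A subring \<open>S\<close> of a ring given by a type class.  It will be the set of the polynomials that involve
  only the vertices of the graph, while the ambient type allows further variables.\<close>

locale coefficient_ring =
  fixes S :: "'r::comm_ring_1 set"
  assumes zero_closed [simp]: "0 \<in> S" and one_closed [simp]: "1 \<in> S"
    and add_closed: "a \<in> S \<Longrightarrow> b \<in> S \<Longrightarrow> a + b \<in> S"
    and mult_closed: "a \<in> S \<Longrightarrow> b \<in> S \<Longrightarrow> a * b \<in> S"
    and uminus_closed: "a \<in> S \<Longrightarrow> - a \<in> S"
begin

lemma diff_closed: "a \<in> S \<Longrightarrow> b \<in> S \<Longrightarrow> a - b \<in> S"
  using add_closed[of a "- b"] uminus_closed[of b] by simp

lemma sum_closed: "(\<And>i. i \<in> I \<Longrightarrow> f i \<in> S) \<Longrightarrow> sum f I \<in> S"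
  by (induction I rule: infinite_finite_induct) (auto intro: add_closed)

lemma prod_closed: "(\<And>i. i \<in> I \<Longrightarrow> f i \<in> S) \<Longrightarrow> prod f I \<in> S"
  by (induction I rule: infinite_finite_induct) (auto intro: mult_closed)

lemma power_closed: "a \<in> S \<Longrightarrow> a ^ k \<in> S"
  by (induction k) (auto intro: mult_closed)

lemma exchange_sign_closed: "exchange_sign \<tau> s \<in> S"
  unfolding exchange_sign_def by (intro power_closed uminus_closed one_closed)

lemmas closed = add_closed mult_closed uminus_closed diff_closed sum_closed exchange_sign_closed

text \<open>Each \<open>X a\<close> is a nonzerodivisor modulo the ideal of \<open>S\<close> generated by any set of the other
  \<open>X s\<close>.  This is regularity of \<open>X\<close> in every order, without the condition that the ideal be
  proper.\<close>

definition weakly_regular :: "(nat \<Rightarrow> 'r) \<Rightarrow> nat set \<Rightarrow> bool" where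
  "weakly_regular X T \<longleftrightarrow>
    (\<forall>T' a r c. T' \<subseteq> T \<longrightarrow> a \<in> T - T' \<longrightarrow> r \<in> S \<longrightarrow> (\<forall>s. c s \<in> S) \<longrightarrow>
      X a * r = (\<Sum>s\<in>T'. X s * c s) \<longrightarrow>
      (\<exists>c'. (\<forall>s. c' s \<in> S) \<and> r = (\<Sum>s\<in>T'. X s * c' s)))"

lemma weakly_regularD:
  assumes "weakly_regular X T" "T' \<subseteq> T" "a \<in> T" "a \<notin> T'" "r \<in> S" "\<And>s. c s \<in> S"
    "X a * r = (\<Sum>s\<in>T'. X s * c s)"
  shows "\<exists>c'. (\<forall>s. c' s \<in> S) \<and> r = (\<Sum>s\<in>T'. X s * c' s)"
proof -
  have "a \<in> T - T'" using assms by simp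
  then show ?thesis
    using assms(1)[unfolded weakly_regular_def, rule_format, of T' a r c] assms by simp
qed

lemma weakly_regular_subset:
  assumes "weakly_regular X T" "T0 \<subseteq> T"
  shows "weakly_regular X T0"
  unfolding weakly_regular_def
proof (intro allI impI)
  fix T' a r c
  assume h: "T' \<subseteq> T0" "a \<in> T0 - T'" "r \<in> S" "\<forall>s. c s \<in> S" "X a * r = (\<Sum>s\<in>T'. X s * c s)"
  have "T' \<subseteq> T" "a \<in> T" "a \<notin> T'" using h(1,2) assms(2) by auto
  then show "\<exists>c'. (\<forall>s. c' s \<in> S) \<and> r = (\<Sum>s\<in>T'. X s * c' s)"
    using weakly_regularD[OF assms(1) _ _ _ h(3) _ h(5)] h(4) by simp
qed

text \<open>The Koszul complex of a weakly regular family is exact in positive degrees.  The induction adds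
  a largest index \<open>a\<close>.  The part of a cycle on sets containing \<open>a\<close> is a cycle of one degree less
  over \<open>T\<close>, hence a boundary (by regularity if its degree is 0); after correcting by it, the
  remaining part is a cycle over \<open>T\<close>.\<close>

lemma koszul_exact:
  assumes "finite T" "weakly_regular X T" "\<And>s. s \<in> T \<Longrightarrow> X s \<in> S" "\<And>\<sigma>. w \<sigma> \<in> S"
    and "\<And>\<tau>. \<tau> \<subseteq> T \<Longrightarrow> card \<tau> = p \<Longrightarrow> koszul_diff X T w \<tau> = 0"
  shows "\<exists>v. (\<forall>\<sigma>. v \<sigma> \<in> S) \<and> (\<forall>\<sigma>. \<sigma> \<subseteq> T \<and> card \<sigma> = Suc p \<longrightarrow> w \<sigma> = koszul_diff X T v \<sigma>)"
  using assms
proof (induction T arbitrary: w p rule: finite_linorder_max_induct)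
  case empty
  then show ?case by (intro exI[of _ "\<lambda>_. 0"]) auto
next
  case (insert a T)
  note regT = weakly_regular_subset[OF insert.prems(1) subset_insertI]
  have a: "a \<notin> T" using insert.hyps by blast
  have XS: "X s \<in> S" if "s \<in> insert a T" for s using insert.prems(2) that by blast
  have fin: "finite \<tau>" if "\<tau> \<subseteq> T" for \<tau> using that insert.hyps finite_subset by blast
  \<comment> \<open>As \<open>a\<close> exceeds all elements of \<open>T\<close>, it has sign 1 and reverses the other signs.\<close>
  have K1: "koszul_diff X (insert a T) u \<tau> = koszul_diff X T u \<tau> + X a * u (insert a \<tau>)"
    if "\<tau> \<subseteq> T" for u \<tau>
  proof -
    have "insert a T - \<tau> = insert a (T - \<tau>)" "a \<notin> T - \<tau>" using a that by auto
    moreover have "exchange_sign \<tau> a = (1::'r)"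
    proof -
      have "{j \<in> \<tau>. a < j} = {}" using that insert.hyps by force
      then show ?thesis unfolding exchange_sign_def by (simp only: card.empty power_0)
    qed
    ultimately show ?thesis using insert.hyps by (simp add: koszul_diff_def add.commute)
  qed
  have K2: "koszul_diff X (insert a T) u (insert a \<tau>) = - koszul_diff X T (\<lambda>\<rho>. u (insert a \<rho>)) \<tau>"
    if "\<tau> \<subseteq> T" for u \<tau>
  proof -
    have "insert a T - insert a \<tau> = T - \<tau>" using a by auto
    moreover have "exchange_sign (insert a \<tau>) s = - (exchange_sign \<tau> s :: 'r)" if "s \<in> T - \<tau>" for s
      using exchange_sign_insert[of \<tau> a s] fin[OF \<open>\<tau> \<subseteq> T\<close>] \<open>\<tau> \<subseteq> T\<close> a that insert.hyps by auto
    ultimately show ?thesis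
      by (simp add: koszul_diff_def sum_negf[symmetric] insert_commute)
  qed
  define w1 where "w1 \<rho> = w (insert a \<rho>)" for \<rho>
  have w1S: "w1 \<rho> \<in> S" for \<rho> using insert.prems by (simp add: w1_def)
  have cyc0: "koszul_diff X T w \<tau> + X a * w1 \<tau> = 0" if "\<tau> \<subseteq> T" "card \<tau> = p" for \<tau>
    using insert.prems(4)[of \<tau>] K1[OF that(1), of w] that by (auto simp: w1_def)
  have "\<exists>v1. (\<forall>\<sigma>. v1 \<sigma> \<in> S) \<and> (\<forall>\<sigma>. \<sigma> \<subseteq> T \<and> card \<sigma> = p \<longrightarrow> w1 \<sigma> = koszul_diff X T v1 \<sigma>)"
  proof (cases p)
    case 0
    have "koszul_diff X T w {} + X a * w1 {} = 0" using cyc0[of "{}"] 0 by simp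
    then have "X a * w1 {} = (\<Sum>s\<in>T. X s * - w {s})"
      by (simp add: koszul_diff_def exchange_sign_def sum_negf eq_neg_iff_add_eq_0 add.commute)
    then obtain c where c: "\<And>s. c s \<in> S" "w1 {} = (\<Sum>s\<in>T. X s * c s)"
      using weakly_regularD[where c = "\<lambda>s. - w {s}", OF insert.prems(1) subset_insertI insertI1 a w1S
          uminus_closed[OF insert.prems(3)]] by blast
    have "w1 {} = koszul_diff X T (\<lambda>\<sigma>. c (the_elem \<sigma>)) {}"
      using c by (simp add: koszul_diff_def exchange_sign_def)
    then show ?thesis using c(1) 0 fin
      by (intro exI[of _ "\<lambda>\<sigma>. c (the_elem \<sigma>)"]) (auto simp: card_eq_0_iff)
  next
    case (Suc q)
    have "koszul_diff X T w1 \<tau> = 0" if "\<tau> \<subseteq> T" "card \<tau> = q" for \<tau>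
    proof -
      have "card (insert a \<tau>) = p" using that Suc a fin[OF that(1)] by (auto simp: card_insert_if)
      then have "koszul_diff X (insert a T) w (insert a \<tau>) = 0"
        using insert.prems(4)[of "insert a \<tau>"] that by blast
      then show ?thesis using K2[OF that(1), of w] by (simp add: w1_def[abs_def])
    qed
    then show ?thesis
      using insert.IH[OF regT, of w1 q] XS w1S Suc by auto
  qed
  then obtain v1 where v1: "\<And>\<sigma>. v1 \<sigma> \<in> S"
    "\<And>\<sigma>. \<sigma> \<subseteq> T \<Longrightarrow> card \<sigma> = p \<Longrightarrow> w1 \<sigma> = koszul_diff X T v1 \<sigma>" by blast
  define w0 where "w0 \<sigma> = w \<sigma> + X a * v1 \<sigma>" for \<sigma>
  have "koszul_diff X T w0 \<tau> = 0" if "\<tau> \<subseteq> T" "card \<tau> = p" for \<tau>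
  proof -
    have "koszul_diff X T w0 \<tau> = koszul_diff X T w \<tau> + X a * koszul_diff X T v1 \<tau>"
      by (simp add: koszul_diff_def w0_def algebra_simps sum.distrib sum_distrib_left)
    then show ?thesis using cyc0[OF that] v1(2)[OF that] by simp
  qed
  moreover have "w0 \<sigma> \<in> S" for \<sigma>
    unfolding w0_def using insert.prems v1(1) XS by (auto intro!: closed)
  ultimately obtain v0 where v0: "\<And>\<sigma>. v0 \<sigma> \<in> S"
    "\<And>\<sigma>. \<sigma> \<subseteq> T \<Longrightarrow> card \<sigma> = Suc p \<Longrightarrow> w0 \<sigma> = koszul_diff X T v0 \<sigma>"
    using insert.IH[OF regT, of w0 p] XS by (metis insertI2)
  define v where "v \<sigma> = (if a \<in> \<sigma> then - v1 (\<sigma> - {a}) else v0 \<sigma>)" for \<sigma>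
  have v_old: "koszul_diff X T v \<sigma> = koszul_diff X T v0 \<sigma>" if "\<sigma> \<subseteq> T" for \<sigma>
    using that a unfolding koszul_diff_def v_def by (intro sum.cong) auto
  have v_new: "koszul_diff X T (\<lambda>\<rho>. v (insert a \<rho>)) \<sigma> = - koszul_diff X T v1 \<sigma>" if "\<sigma> \<subseteq> T" for \<sigma>
    unfolding koszul_diff_def sum_negf[symmetric]
  proof (intro sum.cong refl)
    fix s assume "s \<in> T - \<sigma>"
    then have "insert a (insert s \<sigma>) - {a} = insert s \<sigma>" using that a by auto
    then show "exchange_sign \<sigma> s * (X s * v (insert a (insert s \<sigma>))) =
      - (exchange_sign \<sigma> s * (X s * v1 (insert s \<sigma>)))" by (simp add: v_def)
  qed
  have "w \<sigma> = koszul_diff X (insert a T) v \<sigma>" if sig: "\<sigma> \<subseteq> insert a T" "card \<sigma> = Suc p" for \<sigma>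
  proof (cases "a \<in> \<sigma>")
    case False
    then have s: "\<sigma> \<subseteq> T" using sig by auto
    have "insert a \<sigma> - {a} = \<sigma>" using False by auto
    then have "koszul_diff X (insert a T) v \<sigma> = w0 \<sigma> - X a * v1 \<sigma>"
      using K1[OF s, of v] v_old[OF s] v0(2)[OF s] sig by (simp add: v_def)
    then show ?thesis by (simp add: w0_def)
  next
    case True
    define \<tau> where "\<tau> = \<sigma> - {a}"
    have t: "\<tau> \<subseteq> T" "\<sigma> = insert a \<tau>" "a \<notin> \<tau>" using True sig by (auto simp: \<tau>_def)
    have "card \<tau> = p" using sig t fin[OF t(1)] by simp
    then show ?thesis using K2[OF t(1), of v] v_new[OF t(1)] v1(2)[OF t(1)]
      by (simp add: t(2) w1_def)
  qed
  moreover have "v \<sigma> \<in> S" for \<sigma> using v1(1) v0(1) by (simp add: v_def uminus_closed)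
  ultimately show ?case by blast
qed

end

section \<open>The complex of a meet-semilattice of sets\<close>

text \<open>
  The abstract form of the complex.  The members \<open>D\<close> of \<open>\<D>\<close> stand for the minimal vertex covers \<open>C\<close>,
  by \<open>D = {s. y'\<^sub>s \<in> C}\<close>, and \<open>X s\<close>, \<open>Y s\<close> for the monomials \<open>x'\<^sub>s\<close>, \<open>y'\<^sub>s\<close>.  Only closure of \<open>\<D>\<close> under
  intersection is needed for the complex; exactness has further hypotheses.
\<close>

locale exchange_complex = coefficient_ring S for S :: "'r::comm_ring_1 set" +
  fixes d :: nat and \<D> :: "nat set set" and X Y :: "nat \<Rightarrow> 'r"
  assumes subset: "D \<in> \<D> \<Longrightarrow> D \<subseteq> {1..d}"
    and inter: "D \<in> \<D> \<Longrightarrow> D' \<in> \<D> \<Longrightarrow> D \<inter> D' \<in> \<D>"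
    and X_closed: "s \<in> {1..d} \<Longrightarrow> X s \<in> S" and Y_closed: "s \<in> {1..d} \<Longrightarrow> Y s \<in> S"
begin

text \<open>The indices \<open>s\<close> with \<open>x'\<^sub>s\<close> in \<open>\<C>(H;C)\<close>.\<close>

definition removable :: "nat set \<Rightarrow> nat set" where
  "removable D = {s \<in> D. D - {s} \<in> \<D>}"

text \<open>The basis symbols \<open>\<^bold>f(C;\<sigma>)\<close> of degree \<open>p\<close>.\<close>

definition cells :: "nat \<Rightarrow> (nat set \<times> nat set) set" where
  "cells p = {(D, \<sigma>). D \<in> \<D> \<and> \<sigma> \<subseteq> removable D \<and> card \<sigma> = p}"

text \<open>The elements of \<open>F\<^sub>p\<close> as coordinate functions, with \<open>\<phi> D \<sigma>\<close> the coordinate at \<open>\<^bold>f(C;\<sigma>)\<close>; coordinates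
  outside the basis are 0.\<close>

definition chains :: "nat \<Rightarrow> (nat set \<Rightarrow> nat set \<Rightarrow> 'r) set" where
  "chains p = {\<phi>. (\<forall>D \<sigma>. \<phi> D \<sigma> \<in> S) \<and> (\<forall>D \<sigma>. (D, \<sigma>) \<notin> cells p \<longrightarrow> \<phi> D \<sigma> = 0)}"

text \<open>The differential in coordinates.  A summand \<open>\<^bold>f(C;\<sigma>)\<close> contributes to the coordinate at \<open>(D, \<tau>)\<close>
  through an index \<open>s\<close> with \<open>\<sigma> = \<tau> \<union> {s}\<close>, with factor \<open>- X s\<close> if it lives over \<open>D\<close> and with factor
  \<open>Y s\<close> if it lives over \<open>D \<union> {s}\<close>; \<open>transport s\<close> collects both contributions.\<close>

definition transport :: "nat \<Rightarrow> (nat set \<Rightarrow> nat set \<Rightarrow> 'r) \<Rightarrow> nat set \<Rightarrow> nat set \<Rightarrow> 'r" where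
  "transport s \<phi> D \<sigma> = (if s \<in> D then 0 else Y s * \<phi> (insert s D) \<sigma>) - X s * \<phi> D \<sigma>"

definition boundary :: "(nat set \<Rightarrow> nat set \<Rightarrow> 'r) \<Rightarrow> nat set \<Rightarrow> nat set \<Rightarrow> 'r" where
  "boundary \<phi> D \<tau> = (\<Sum>s\<in>{1..d} - \<tau>. exchange_sign \<tau> s * transport s \<phi> D (insert s \<tau>))"

text \<open>The monomial \<open>\<^bold>z\<^sub>C\<close>, and the augmentation in coordinates.\<close>

definition weight :: "nat set \<Rightarrow> 'r" where
  "weight D = (\<Prod>s\<in>{1..d} - D. X s) * (\<Prod>s\<in>D. Y s)"

definition augment :: "(nat set \<Rightarrow> nat set \<Rightarrow> 'r) \<Rightarrow> 'r" where
  "augment \<phi> = (\<Sum>D\<in>\<D>. \<phi> D {} * weight D)"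

lemma finite_DD: "finite \<D>"
  using subset by (intro finite_subset[of \<D> "Pow {1..d}"]) auto

lemma removable_subset: "D \<in> \<D> \<Longrightarrow> removable D \<subseteq> {1..d}"
  using subset by (auto simp: removable_def)

lemma removable_Diff:
  assumes "s \<in> removable D"
  shows "D - {s} \<in> \<D>" "removable D - {s} \<subseteq> removable (D - {s})"
proof -
  show 1: "D - {s} \<in> \<D>" using assms by (simp add: removable_def)
  show "removable D - {s} \<subseteq> removable (D - {s})"
  proof
    fix t assume t: "t \<in> removable D - {s}"
    then have "(D - {s}) \<inter> (D - {t}) \<in> \<D>" using inter 1 by (auto simp: removable_def)
    moreover have "(D - {s}) \<inter> (D - {t}) = D - {s} - {t}" by auto
    ultimately show "t \<in> removable (D - {s})" using t by (auto simp: removable_def)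
  qed
qed

lemma cellsD:
  assumes "(D, \<sigma>) \<in> cells p"
  shows "D \<in> \<D>" "D \<subseteq> {1..d}" "\<sigma> \<subseteq> removable D" "\<sigma> \<subseteq> D" "\<sigma> \<subseteq> {1..d}" "card \<sigma> = p" "finite \<sigma>"
proof -
  show *: "D \<in> \<D>" "D \<subseteq> {1..d}" "\<sigma> \<subseteq> removable D" "card \<sigma> = p"
    using assms subset by (auto simp: cells_def)
  then show "\<sigma> \<subseteq> D" "\<sigma> \<subseteq> {1..d}" using removable_subset by (auto simp: removable_def)
  then show "finite \<sigma>" using finite_subset by blast
qed

lemma chainsD:
  assumes "\<phi> \<in> chains p"
  shows "\<phi> D \<sigma> \<in> S" "(D, \<sigma>) \<notin> cells p \<Longrightarrow> \<phi> D \<sigma> = 0"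
  using assms by (auto simp: chains_def)

lemma cells_face:
  assumes "(D, insert s \<tau>) \<in> cells (Suc p)" "s \<notin> \<tau>"
  shows "(D, \<tau>) \<in> cells p" "(D - {s}, \<tau>) \<in> cells p"
proof -
  note c = cellsD[OF assms(1)]
  have "card \<tau> = p" using c(6,7) assms(2) by simp
  moreover have "s \<in> removable D" "\<tau> \<subseteq> removable D - {s}" using c(3) assms(2) by auto
  ultimately show "(D, \<tau>) \<in> cells p" "(D - {s}, \<tau>) \<in> cells p"
    using c removable_Diff[of s D] by (auto simp: cells_def)
qed

lemma transport_closed: "s \<in> {1..d} \<Longrightarrow> \<phi> \<in> chains p \<Longrightarrow> transport s \<phi> D \<sigma> \<in> S"
  using chainsD(1)[of \<phi> p]
  by (auto simp: transport_def intro!: diff_closed uminus_closed mult_closed X_closed Y_closed)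

lemma transport_commute:
  "s \<noteq> t \<Longrightarrow> transport s (transport t \<phi>) D \<sigma> = transport t (transport s \<phi>) D \<sigma>"
  by (simp add: transport_def insert_commute algebra_simps)

lemma boundary_closed:
  assumes "\<phi> \<in> chains (Suc p)"
  shows "boundary \<phi> \<in> chains p"
  unfolding chains_def
proof (intro CollectI conjI allI impI)
  fix D \<tau>
  show "boundary \<phi> D \<tau> \<in> S" unfolding boundary_def
    by (intro closed transport_closed[OF _ assms]) auto
  assume nc: "(D, \<tau>) \<notin> cells p"
  show "boundary \<phi> D \<tau> = 0" unfolding boundary_def
  proof (intro sum.neutral ballI)
    fix s assume s: "s \<in> {1..d} - \<tau>"
    have "\<phi> D (insert s \<tau>) = 0"
      using chainsD(2)[OF assms] cells_face(1)[of D s \<tau> p] nc s by blast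
    moreover have "\<phi> (insert s D) (insert s \<tau>) = 0" if "s \<notin> D"
      using chainsD(2)[OF assms] cells_face(2)[of "insert s D" s \<tau> p] nc s that by fastforce
    ultimately show "exchange_sign \<tau> s * transport s \<phi> D (insert s \<tau>) = 0"
      by (simp add: transport_def)
  qed
qed

lemma chains_diff: "\<phi> \<in> chains p \<Longrightarrow> \<psi> \<in> chains p \<Longrightarrow> (\<lambda>D \<sigma>. \<phi> D \<sigma> - \<psi> D \<sigma>) \<in> chains p"
  by (auto simp: chains_def intro: diff_closed)

lemma chains_add: "\<phi> \<in> chains p \<Longrightarrow> \<psi> \<in> chains p \<Longrightarrow> (\<lambda>D \<sigma>. \<phi> D \<sigma> + \<psi> D \<sigma>) \<in> chains p"
  by (auto simp: chains_def intro: add_closed)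

lemma boundary_diff: "boundary (\<lambda>D \<sigma>. \<phi> D \<sigma> - \<psi> D \<sigma>) D \<tau> = boundary \<phi> D \<tau> - boundary \<psi> D \<tau>"
  unfolding boundary_def sum_subtractf[symmetric]
  by (intro sum.cong refl) (simp add: transport_def algebra_simps)

lemma boundary_add: "boundary (\<lambda>D \<sigma>. \<phi> D \<sigma> + \<psi> D \<sigma>) D \<tau> = boundary \<phi> D \<tau> + boundary \<psi> D \<tau>"
  unfolding boundary_def sum.distrib[symmetric]
  by (intro sum.cong refl) (simp add: transport_def algebra_simps)

lemma augment_diff: "augment (\<lambda>D \<sigma>. \<phi> D \<sigma> - \<psi> D \<sigma>) = augment \<phi> - augment \<psi>"
  by (simp add: augment_def algebra_simps sum_subtractf)

text \<open>The operators \<open>transport s\<close> and \<open>transport t\<close> commute, and the signs attached to them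
  anticommute.\<close>

lemma boundary_boundary:
  assumes "\<phi> \<in> chains (Suc (Suc p))"
  shows "boundary (boundary \<phi>) D \<tau> = 0"
proof (cases "(D, \<tau>) \<in> cells p")
  case False
  then show ?thesis using boundary_closed[OF boundary_closed[OF assms]] chainsD(2) by blast
next
  case True
  have fin: "finite \<tau>" using cellsD[OF True] by simp
  let ?A = "{1..d} - \<tau>"
  define g where "g s t = (if s = t then 0 else exchange_sign \<tau> s * (exchange_sign (insert s \<tau>) t *
      transport s (transport t \<phi>) D (insert t (insert s \<tau>))))" for s t
  have tr: "transport s (boundary \<phi>) D (insert s \<tau>) =
      (\<Sum>t\<in>{1..d} - insert s \<tau>. exchange_sign (insert s \<tau>) t *
          transport s (transport t \<phi>) D (insert t (insert s \<tau>)))" for s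
    by (cases "s \<in> D") (auto simp: transport_def boundary_def sum_distrib_left
        insert_commute algebra_simps simp flip: sum_negf sum_subtractf intro!: sum.cong)
  have "boundary (boundary \<phi>) D \<tau> = (\<Sum>s\<in>?A. \<Sum>t\<in>?A. g s t)"
    unfolding boundary_def[of "boundary \<phi>"] tr
  proof (intro sum.cong refl)
    fix s assume s: "s \<in> ?A"
    have eq: "?A = insert s ({1..d} - insert s \<tau>)" using s by auto
    have "(\<Sum>t\<in>?A. g s t) = (\<Sum>t\<in>{1..d} - insert s \<tau>. g s t)"
      by (subst eq, subst sum.insert) (auto simp: g_def)
    also have "\<dots> = (\<Sum>t\<in>{1..d} - insert s \<tau>. exchange_sign \<tau> s * (exchange_sign (insert s \<tau>) t *
      transport s (transport t \<phi>) D (insert t (insert s \<tau>))))"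
      by (intro sum.cong) (auto simp: g_def)
    finally show "exchange_sign \<tau> s * (\<Sum>t\<in>{1..d} - insert s \<tau>. exchange_sign (insert s \<tau>) t *
          transport s (transport t \<phi>) D (insert t (insert s \<tau>))) = (\<Sum>t\<in>?A. g s t)"
      by (simp add: sum_distrib_left)
  qed
  also have "\<dots> = 0"
  proof (intro sum_alternating_eq_0)
    fix s t assume st: "s \<in> ?A" "t \<in> ?A" "s \<noteq> t"
    have "exchange_sign \<tau> s * exchange_sign (insert s \<tau>) t =
        - (exchange_sign \<tau> t * exchange_sign (insert t \<tau>) s :: 'r)"
      using exchange_sign_anticommute[OF fin] st by blast
    then show "g s t = - g t s"
      using st transport_commute[OF st(3), of \<phi>]
      by (simp add: g_def insert_commute flip: mult.assoc)
  qed (auto simp: g_def)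
  finally show ?thesis .
qed

lemma weight_exchange:
  assumes "D \<subseteq> {1..d}" "s \<in> D"
  shows "Y s * weight (D - {s}) = X s * weight D"
proof -
  have 1: "{1..d} - (D - {s}) = insert s ({1..d} - D)" using assms by auto
  have "finite D" using assms finite_subset by blast
  then have "(\<Prod>s\<in>D. Y s) = Y s * (\<Prod>s\<in>D - {s}. Y s)" using assms(2) by (rule prod.remove)
  then show ?thesis using assms unfolding weight_def 1 by (simp add: mult_ac)
qed

lemma augment_boundary:
  assumes "\<phi> \<in> chains 1"
  shows "augment (boundary \<phi>) = 0"
proof -
  have "augment (boundary \<phi>) = (\<Sum>D\<in>\<D>. \<Sum>s\<in>{1..d}. transport s \<phi> D {s} * weight D)"
    unfolding augment_def boundary_def by (simp add: exchange_sign_def sum_distrib_right)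
  also have "\<dots> = (\<Sum>s\<in>{1..d}. \<Sum>D\<in>\<D>. transport s \<phi> D {s} * weight D)"
    by (rule sum.swap)
  also have "\<dots> = 0"
  proof (rule sum.neutral, rule ballI)
    fix s assume s: "s \<in> {1..d}"
    let ?B = "{D \<in> \<D>. s \<in> removable D}"
    let ?C = "{D \<in> \<D>. s \<notin> D \<and> insert s D \<in> \<D>}"
    have z: "\<phi> D {s} = 0" if "D \<notin> \<D> \<or> s \<notin> removable D" for D
      using that chainsD(2)[OF assms, of D "{s}"] by (auto simp: cells_def)
    have z': "\<phi> (insert s D) {s} = 0" if "insert s D \<notin> \<D>" for D
      by (rule z) (use that in blast)
    \<comment> \<open>The \<open>Y\<close>-part, reindexed along \<open>D \<mapsto> D \<union> {s}\<close>, cancels the \<open>X\<close>-part.\<close>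
    have "(\<Sum>D\<in>\<D>. transport s \<phi> D {s} * weight D) =
       (\<Sum>D\<in>\<D>. (if s \<in> D then 0 else Y s * \<phi> (insert s D) {s} * weight D)) -
       (\<Sum>D\<in>\<D>. X s * \<phi> D {s} * weight D)"
      unfolding sum_subtractf[symmetric] by (intro sum.cong) (auto simp: transport_def algebra_simps)
    also have "(\<Sum>D\<in>\<D>. (if s \<in> D then 0 else Y s * \<phi> (insert s D) {s} * weight D)) =
       (\<Sum>D\<in>?C. Y s * \<phi> (insert s D) {s} * weight D)"
      using finite_DD
      by (intro sum.mono_neutral_cong_right) (auto, metis z' mult_zero_left mult_zero_right)
    also have "\<dots> = (\<Sum>D\<in>?B. Y s * \<phi> D {s} * weight (D - {s}))"
      by (rule sum.reindex_bij_witness[of _ "\<lambda>D. D - {s}" "insert s"])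
        (auto simp: removable_def insert_absorb)
    also have "\<dots> = (\<Sum>D\<in>?B. X s * \<phi> D {s} * weight D)"
    proof (intro sum.cong refl)
      fix D assume "D \<in> ?B"
      then have "Y s * weight (D - {s}) = X s * weight D"
        using subset by (intro weight_exchange) (auto simp: removable_def)
      then show "Y s * \<phi> D {s} * weight (D - {s}) = X s * \<phi> D {s} * weight D"
        by (metis mult.assoc mult.commute)
    qed
    also have "\<dots> = (\<Sum>D\<in>\<D>. X s * \<phi> D {s} * weight D)"
      using finite_DD by (intro sum.mono_neutral_left) (auto simp: z)
    finally show "(\<Sum>D\<in>\<D>. transport s \<phi> D {s} * weight D) = 0" by simp
  qed
  finally show ?thesis .
qed

text \<open>On the members of \<open>\<D>\<close> of maximal size in the support of a chain only the \<open>X\<close>-part of the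
  differential is visible, and it is a Koszul differential.\<close>

lemma boundary_top:
  assumes "\<phi> \<in> chains (Suc p)" "D \<in> \<D>" "\<And>D' \<sigma>. card D' > card D \<Longrightarrow> \<phi> D' \<sigma> = 0"
  shows "boundary \<phi> D \<tau> = - koszul_diff X (removable D) (\<phi> D) \<tau>"
proof -
  have finD: "finite D" using subset[OF assms(2)] finite_subset by blast
  have tr: "transport s \<phi> D \<rho> = - (X s * \<phi> D \<rho>)" for s \<rho>
    using finD assms(3)[of "insert s D"] by (simp add: transport_def)
  have "boundary \<phi> D \<tau> = (\<Sum>s\<in>removable D - \<tau>. exchange_sign \<tau> s * - (X s * \<phi> D (insert s \<tau>)))"
    unfolding boundary_def tr
  proof (intro sum.mono_neutral_right ballI)
    fix s assume "s \<in> {1..d} - \<tau> - (removable D - \<tau>)"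
    then have "(D, insert s \<tau>) \<notin> cells (Suc p)" using cellsD(3) by blast
    then show "exchange_sign \<tau> s * - (X s * \<phi> D (insert s \<tau>)) = 0"
      using chainsD(2)[OF assms(1)] by simp
  qed (use removable_subset[OF assms(2)] in auto)
  then show ?thesis by (simp add: koszul_diff_def sum_negf)
qed

text \<open>
  The lifting argument common to all degrees.  \<open>Z\<close> is the set of cycles.  If the top part of each cycle,
  with respect to the filtration by the size of \<open>D\<close>, is a Koszul boundary, then subtracting
  boundaries lowers the top size until the cycle is exhausted.
\<close>

lemma filtration_lifting:
  assumes Z: "\<And>\<phi>. \<phi> \<in> Z \<Longrightarrow> \<phi> \<in> chains p"
    and Z_diff: "\<And>\<phi> \<psi>. \<phi> \<in> Z \<Longrightarrow> \<psi> \<in> chains (Suc p) \<Longrightarrow>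
        (\<lambda>D \<sigma>. \<phi> D \<sigma> - boundary \<psi> D \<sigma>) \<in> Z"
    and top: "\<And>\<phi> D. \<phi> \<in> Z \<Longrightarrow> D \<in> \<D> \<Longrightarrow> (\<And>D' \<sigma>. card D' > card D \<Longrightarrow> \<phi> D' \<sigma> = 0) \<Longrightarrow>
        \<exists>v. (\<forall>\<sigma>. v \<sigma> \<in> S) \<and>
          (\<forall>\<sigma>. \<sigma> \<subseteq> removable D \<and> card \<sigma> = p \<longrightarrow> \<phi> D \<sigma> = koszul_diff X (removable D) v \<sigma>)"
    and \<phi>: "\<phi> \<in> Z"
  shows "\<exists>\<psi>\<in>chains (Suc p). boundary \<psi> = \<phi>"
proof -
  have "\<exists>\<psi>\<in>chains (Suc p). boundary \<psi> = \<phi>"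
    if "\<phi> \<in> Z" "\<And>D \<sigma>. card D \<ge> k \<Longrightarrow> \<phi> D \<sigma> = 0" for k \<phi>
    using that
  proof (induction k arbitrary: \<phi>)
    case 0
    have "(\<lambda>D \<sigma>. 0) \<in> chains (Suc p)" by (simp add: chains_def)
    moreover have "boundary (\<lambda>D \<sigma>. 0) = \<phi>"
      using 0 by (intro ext) (auto simp: boundary_def transport_def intro!: sum.neutral)
    ultimately show ?case by blast
  next
    case (Suc k)
    note ch = Z[OF Suc.prems(1)]
    have "\<exists>v. (\<forall>\<sigma>. v \<sigma> \<in> S) \<and>
          (\<forall>\<sigma>. \<sigma> \<subseteq> removable D \<and> card \<sigma> = p \<longrightarrow> \<phi> D \<sigma> = koszul_diff X (removable D) v \<sigma>)"
      if "D \<in> \<D> \<and> card D = k" for D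
      using top[OF Suc.prems(1), of D] Suc.prems(2) that by simp
    then obtain V where VS: "\<And>D \<sigma>. D \<in> \<D> \<and> card D = k \<Longrightarrow> V D \<sigma> \<in> S"
      and V: "\<And>D \<sigma>. D \<in> \<D> \<and> card D = k \<Longrightarrow> \<sigma> \<subseteq> removable D \<Longrightarrow> card \<sigma> = p \<Longrightarrow>
        \<phi> D \<sigma> = koszul_diff X (removable D) (V D) \<sigma>"
      by metis
    define \<psi> where
      "\<psi> D \<sigma> = (if (D, \<sigma>) \<in> cells (Suc p) \<and> card D = k then - V D \<sigma> else 0)" for D \<sigma>
    have \<psi>: "\<psi> \<in> chains (Suc p)"
      using VS cellsD(1) by (auto simp: chains_def \<psi>_def intro!: uminus_closed)
    have bd: "boundary \<psi> D \<sigma> = \<phi> D \<sigma>" if D: "card D \<ge> k" for D \<sigma>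
    proof (cases "(D, \<sigma>) \<in> cells p")
      case False
      then show ?thesis using chainsD(2)[OF ch] chainsD(2)[OF boundary_closed[OF \<psi>]] by simp
    next
      case True
      note c = cellsD[OF True]
      have "boundary \<psi> D \<sigma> = - koszul_diff X (removable D) (\<psi> D) \<sigma>"
        using D by (intro boundary_top[OF \<psi> c(1)]) (simp add: \<psi>_def)
      also have "\<dots> = \<phi> D \<sigma>"
      proof (cases "card D = k")
        case False
        then have "\<psi> D = (\<lambda>\<rho>. 0)" by (simp add: \<psi>_def fun_eq_iff)
        then show ?thesis using False D Suc.prems(2)[of D \<sigma>] by (simp add: koszul_diff_def)
      next
        case k: True
        have "- koszul_diff X (removable D) (\<psi> D) \<sigma> = koszul_diff X (removable D) (V D) \<sigma>"
          unfolding koszul_diff_def sum_negf[symmetric]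
        proof (intro sum.cong refl)
          fix s assume "s \<in> removable D - \<sigma>"
          then have "(D, insert s \<sigma>) \<in> cells (Suc p)" using c by (auto simp: cells_def)
          then show "- (exchange_sign \<sigma> s * (X s * \<psi> D (insert s \<sigma>))) =
             exchange_sign \<sigma> s * (X s * V D (insert s \<sigma>))" using k by (simp add: \<psi>_def)
        qed
        also have "\<dots> = \<phi> D \<sigma>" using V[of D \<sigma>] c k by simp
        finally show ?thesis .
      qed
      finally show ?thesis .
    qed
    obtain \<psi>' where \<psi>': "\<psi>' \<in> chains (Suc p)"
      "boundary \<psi>' = (\<lambda>D \<sigma>. \<phi> D \<sigma> - boundary \<psi> D \<sigma>)"
      using Suc.IH[OF Z_diff[OF Suc.prems(1) \<psi>]] bd by auto
    have "boundary (\<lambda>D \<sigma>. \<psi>' D \<sigma> + \<psi> D \<sigma>) = \<phi>"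
      by (intro ext) (simp add: boundary_add \<psi>'(2))
    then show ?case using chains_add[OF \<psi>'(1) \<psi>] by blast
  qed
  moreover have "\<phi> D \<sigma> = 0" if "card D \<ge> Suc d" for D \<sigma>
  proof -
    have "\<not> D \<subseteq> {1..d}" using that card_mono[of "{1..d}" D] by auto
    then show ?thesis using chainsD(2)[OF Z[OF \<phi>]] cellsD(2) by blast
  qed
  ultimately show ?thesis using \<phi> by blast
qed

theorem boundary_exact:
  assumes "weakly_regular X {1..d}" "\<phi> \<in> chains (Suc p)" "boundary \<phi> = (\<lambda>D \<tau>. 0)"
  shows "\<exists>\<psi>\<in>chains (Suc (Suc p)). boundary \<psi> = \<phi>"
proof (rule filtration_lifting[where Z = "{\<phi> \<in> chains (Suc p). boundary \<phi> = (\<lambda>D \<tau>. 0)}"])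
  fix \<phi> \<psi> assume "\<phi> \<in> {\<phi> \<in> chains (Suc p). boundary \<phi> = (\<lambda>D \<tau>. 0)}" "\<psi> \<in> chains (Suc (Suc p))"
  then show "(\<lambda>D \<sigma>. \<phi> D \<sigma> - boundary \<psi> D \<sigma>) \<in> {\<phi> \<in> chains (Suc p). boundary \<phi> = (\<lambda>D \<tau>. 0)}"
    by (auto simp: fun_eq_iff boundary_diff boundary_boundary intro!: chains_diff boundary_closed)
next
  fix \<phi> D assume \<phi>: "\<phi> \<in> {\<phi> \<in> chains (Suc p). boundary \<phi> = (\<lambda>D \<tau>. 0)}" and D: "D \<in> \<D>"
    and top: "\<And>D' \<sigma>. card D' > card D \<Longrightarrow> \<phi> D' \<sigma> = 0"
  have rem: "removable D \<subseteq> {1..d}" by (rule removable_subset[OF D])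
  show "\<exists>v. (\<forall>\<sigma>. v \<sigma> \<in> S) \<and> (\<forall>\<sigma>. \<sigma> \<subseteq> removable D \<and> card \<sigma> = Suc p \<longrightarrow>
      \<phi> D \<sigma> = koszul_diff X (removable D) v \<sigma>)"
  proof (rule koszul_exact)
    show "finite (removable D)" using rem finite_subset by blast
    show "weakly_regular X (removable D)" by (rule weakly_regular_subset[OF assms(1) rem])
    show "X s \<in> S" if "s \<in> removable D" for s using X_closed rem that by blast
    show "\<phi> D \<sigma> \<in> S" for \<sigma> using \<phi> chainsD by blast
    show "koszul_diff X (removable D) (\<phi> D) \<tau> = 0" for \<tau>
      using boundary_top[of \<phi> p D \<tau>] \<phi> D top by auto
  qed
qed (use assms in auto)

text \<open>The hypothesis \<open>colon\<close> says that the colon ideal by \<open>weight D\<close> of the ideal generated by the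
  other weights \<open>weight D'\<close> with \<open>card D' \<le> card D\<close> lies in the ideal generated by the \<open>X s\<close> with
  \<open>s \<in> removable D\<close>.\<close>

theorem augment_exact:
  assumes colon: "\<And>u D. D \<in> \<D> \<Longrightarrow> (\<And>D'. u D' \<in> S) \<Longrightarrow> (\<Sum>D'\<in>\<D>. u D' * weight D') = 0 \<Longrightarrow>
        (\<And>D'. card D' > card D \<Longrightarrow> u D' = 0) \<Longrightarrow>
        \<exists>c. (\<forall>s. c s \<in> S) \<and> u D = (\<Sum>s\<in>removable D. X s * c s)"
    and "\<phi> \<in> chains 0" "augment \<phi> = 0"
  shows "\<exists>\<psi>\<in>chains 1. boundary \<psi> = \<phi>"
  unfolding One_nat_def
proof (rule filtration_lifting[where Z = "{\<phi> \<in> chains 0. augment \<phi> = 0}"])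
  fix \<phi> \<psi> assume "\<phi> \<in> {\<phi> \<in> chains 0. augment \<phi> = 0}" "\<psi> \<in> chains (Suc 0)"
  then show "(\<lambda>D \<sigma>. \<phi> D \<sigma> - boundary \<psi> D \<sigma>) \<in> {\<phi> \<in> chains 0. augment \<phi> = 0}"
    by (auto simp: augment_diff augment_boundary intro!: chains_diff boundary_closed)
next
  fix \<phi> D assume \<phi>: "\<phi> \<in> {\<phi> \<in> chains 0. augment \<phi> = 0}" and D: "D \<in> \<D>"
    and top: "\<And>D' \<sigma>. card D' > card D \<Longrightarrow> \<phi> D' \<sigma> = 0"
  have "\<exists>c. (\<forall>s. c s \<in> S) \<and> \<phi> D {} = (\<Sum>s\<in>removable D. X s * c s)"
    using \<phi> by (intro colon D top) (auto simp: augment_def intro: chainsD)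
  then obtain c where c: "\<And>s. c s \<in> S" "\<phi> D {} = (\<Sum>s\<in>removable D. X s * c s)"
    by blast
  have fin: "\<sigma> = {}" if "\<sigma> \<subseteq> removable D" "card \<sigma> = 0" for \<sigma>
    using that removable_subset[OF D] finite_subset[of \<sigma> "{1..d}"] by auto
  have "\<phi> D {} = koszul_diff X (removable D) (\<lambda>\<sigma>. c (the_elem \<sigma>)) {}"
    using c by (simp add: koszul_diff_def exchange_sign_def)
  then show "\<exists>v. (\<forall>\<sigma>. v \<sigma> \<in> S) \<and> (\<forall>\<sigma>. \<sigma> \<subseteq> removable D \<and> card \<sigma> = 0 \<longrightarrow>
      \<phi> D \<sigma> = koszul_diff X (removable D) v \<sigma>)"
    using c(1) fin by (intro exI[of _ "\<lambda>\<sigma>. c (the_elem \<sigma>)"]) auto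
qed (use assms in auto)

end

section \<open>Monomials in polynomial rings\<close>

lemma carrier_mpoly_ring_iff:
  "p \<in> carrier (mpoly_ring V) \<longleftrightarrow> (\<forall>e\<in>Poly_Mapping.keys p. Poly_Mapping.keys e \<subseteq> V)"
  by (simp add: mpoly_ring_def)

lemma mpoly_ring_simps [simp]:
  "mult (mpoly_ring V) = (*)" "one (mpoly_ring V) = 1" "zero (mpoly_ring V) = 0" "add (mpoly_ring V) = (+)"
  by (simp_all add: mpoly_ring_def)

lemma keys_monomial_add:
  fixes e e' :: "'v monomial"
  shows "Poly_Mapping.keys (e + e') = Poly_Mapping.keys e \<union> Poly_Mapping.keys e'"
  by (auto simp: in_keys_iff lookup_add)

lemma coefficient_ring_mpoly_ring: "coefficient_ring (carrier (mpoly_ring V :: ('v, 'k::field) mpoly ring))"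
proof
  fix p q :: "('v, 'k) mpoly"
  assume p: "p \<in> carrier (mpoly_ring V)"
  then show "- p \<in> carrier (mpoly_ring V)" by (auto simp: carrier_mpoly_ring_iff in_keys_iff)
  assume q: "q \<in> carrier (mpoly_ring V)"
  show "p + q \<in> carrier (mpoly_ring V)"
    using p q keys_add[of p q] unfolding carrier_mpoly_ring_iff by blast
  show "p * q \<in> carrier (mpoly_ring V)"
    unfolding carrier_mpoly_ring_iff
  proof
    fix e assume "e \<in> Poly_Mapping.keys (p * q)"
    then obtain a b where "a \<in> Poly_Mapping.keys p" "b \<in> Poly_Mapping.keys q" "e = a + b"
      using keys_mult[of p q] by blast
    then show "Poly_Mapping.keys e \<subseteq> V"
      using p q by (auto simp: carrier_mpoly_ring_iff keys_monomial_add)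
  qed
qed (auto simp: carrier_mpoly_ring_iff)

lemma cring_mpoly_ring: "cring (mpoly_ring V :: ('v, 'k::field) mpoly ring)"
proof -
  interpret coefficient_ring "carrier (mpoly_ring V :: ('v, 'k) mpoly ring)"
    by (rule coefficient_ring_mpoly_ring)
  show ?thesis
  proof (rule cringI)
    show "abelian_group (mpoly_ring V :: ('v, 'k) mpoly ring)"
    proof (rule abelian_groupI)
      fix p :: "('v, 'k) mpoly" assume "p \<in> carrier (mpoly_ring V)"
      then show "\<exists>q\<in>carrier (mpoly_ring V). q \<oplus>\<^bsub>mpoly_ring V\<^esub> p = \<zero>\<^bsub>mpoly_ring V\<^esub>"
        by (intro bexI[of _ "- p"]) (auto intro: uminus_closed)
    qed (auto intro: add_closed)
    show "Group.comm_monoid (mpoly_ring V :: ('v, 'k) mpoly ring)"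
      by (rule comm_monoidI) (auto intro: mult_closed)
  qed (auto simp: algebra_simps)
qed

lemma single_mem_mpoly_ring:
  "Poly_Mapping.keys e \<subseteq> V \<Longrightarrow> Poly_Mapping.single e a \<in> carrier (mpoly_ring V)"
  by (auto simp: carrier_mpoly_ring_iff split: if_splits)

lemma prod_Var:
  "finite A \<Longrightarrow> (\<Prod>w\<in>A. Var w) = Poly_Mapping.single (\<Sum>w\<in>A. Poly_Mapping.single w 1) 1"
  by (induction A rule: finite_induct) (simp_all add: Var_def mult_single)

lemma keys_monomial_mult:
  fixes p :: "('v, 'k::field) mpoly"
  shows "Poly_Mapping.keys (Poly_Mapping.single m 1 * p) = (+) m ` Poly_Mapping.keys p"
proof -
  have l: "Poly_Mapping.lookup (Poly_Mapping.single m 1 * p) k = (\<Sum>q. Poly_Mapping.lookup p q when k = m + q)" for k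
    by (simp add: lookup_mult lookup_single when_mult)
  have eq: "Poly_Mapping.lookup (Poly_Mapping.single m 1 * p) (m + e) = Poly_Mapping.lookup p e" for e
    by (simp add: l)
  have "Poly_Mapping.lookup (Poly_Mapping.single m 1 * p) k = 0" if "k \<notin> range ((+) m)" for k
  proof -
    have "(\<lambda>q. Poly_Mapping.lookup p q when k = m + q) = (\<lambda>q. 0)"
      using that by (auto simp: when_def fun_eq_iff)
    then show ?thesis unfolding l by (simp only: Sum_any.neutral simp_thms)
  qed
  then have "k \<in> range ((+) m)" if "k \<in> Poly_Mapping.keys (Poly_Mapping.single m 1 * p)" for k
    using that by (auto simp: in_keys_iff)
  then have "Poly_Mapping.keys (Poly_Mapping.single m 1 * p) =
      (+) m ` {e. m + e \<in> Poly_Mapping.keys (Poly_Mapping.single m 1 * p)}"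
    by blast
  then show ?thesis by (simp add: in_keys_iff eq Poly_Mapping.keys.rep_eq)
qed

lemma sum_single_lookup:
  "(\<Sum>e\<in>Poly_Mapping.keys p. Poly_Mapping.single e (Poly_Mapping.lookup p e)) = p"
  by (rule poly_mapping_eqI) (auto simp: lookup_sum lookup_single when_def in_keys_iff)

text \<open>A polynomial lies in a monomial ideal if each of its monomials is divisible by a generator.\<close>

lemma mem_monomial_ideal:
  fixes p :: "('v, 'k::field) mpoly"
  assumes p: "p \<in> carrier (mpoly_ring V)" and T: "finite T"
    and div: "\<And>e. e \<in> Poly_Mapping.keys p \<Longrightarrow> \<exists>s\<in>T. \<exists>r. e = m s + r"
  shows "\<exists>c. (\<forall>s. c s \<in> carrier (mpoly_ring V)) \<and> p = (\<Sum>s\<in>T. Poly_Mapping.single (m s) 1 * c s)"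
proof -
  interpret coefficient_ring "carrier (mpoly_ring V :: ('v, 'k) mpoly ring)"
    by (rule coefficient_ring_mpoly_ring)
  let ?K = "Poly_Mapping.keys p"
  have "\<forall>e\<in>?K. \<exists>s r. s \<in> T \<and> e = m s + r" using div by blast
  then obtain \<sigma> \<rho> where sr: "\<And>e. e \<in> ?K \<Longrightarrow> \<sigma> e \<in> T \<and> e = m (\<sigma> e) + \<rho> e" by metis
  define c where "c s = (\<Sum>e\<in>{e \<in> ?K. \<sigma> e = s}. Poly_Mapping.single (\<rho> e) (Poly_Mapping.lookup p e))" for s
  have "c s \<in> carrier (mpoly_ring V)" for s
    unfolding c_def
  proof (intro sum_closed single_mem_mpoly_ring)
    fix e assume "e \<in> {e \<in> ?K. \<sigma> e = s}"
    then show "Poly_Mapping.keys (\<rho> e) \<subseteq> V"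
      using p sr[of e] keys_monomial_add[of "m (\<sigma> e)" "\<rho> e"] by (auto simp: carrier_mpoly_ring_iff)
  qed
  moreover have "p = (\<Sum>s\<in>T. Poly_Mapping.single (m s) 1 * c s)"
  proof -
    have "(\<Sum>s\<in>T. Poly_Mapping.single (m s) 1 * c s) =
        (\<Sum>s\<in>T. \<Sum>e\<in>{e \<in> ?K. \<sigma> e = s}. Poly_Mapping.single e (Poly_Mapping.lookup p e))"
      unfolding c_def sum_distrib_left
      by (intro sum.cong refl) (use sr in \<open>auto simp: mult_single\<close>)
    also have "\<dots> = (\<Sum>e\<in>?K. Poly_Mapping.single e (Poly_Mapping.lookup p e))"
      using T sr by (intro sum.group) auto
    finally show ?thesis by (simp add: sum_single_lookup)
  qed
  ultimately show ?thesis by blast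
qed

text \<open>Conversely, each monomial of an element of a monomial ideal is divisible by a generator; the
  element is here a monomial multiple of \<open>r\<close>.\<close>

lemma keys_of_monomial_combination:
  fixes c :: "'i \<Rightarrow> ('v, 'k::field) mpoly"
  assumes "Poly_Mapping.single m 1 * r = (\<Sum>i\<in>I. Poly_Mapping.single (M i) 1 * c i)"
    and "e \<in> Poly_Mapping.keys r"
  obtains i e' where "i \<in> I" "e' \<in> Poly_Mapping.keys (c i)" "m + e = M i + e'"
proof -
  have "m + e \<in> Poly_Mapping.keys (Poly_Mapping.single m 1 * r)"
    unfolding keys_monomial_mult using assms(2) by blast
  then obtain i where "i \<in> I" "m + e \<in> Poly_Mapping.keys (Poly_Mapping.single (M i) 1 * c i)"
    unfolding assms(1) using keys_sum[of "\<lambda>i. Poly_Mapping.single (M i) 1 * c i" I] by blast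
  then show thesis unfolding keys_monomial_mult using that by blast
qed

lemma monomial_divides:
  fixes e m :: "'v monomial"
  assumes "\<And>v. Poly_Mapping.lookup m v \<le> Poly_Mapping.lookup e v"
  shows "\<exists>r. e = m + r"
  by (rule exI[of _ "e - m"], rule poly_mapping_eqI) (simp add: lookup_add lookup_minus assms)

lemma weakly_regular_monomials:
  fixes M :: "nat \<Rightarrow> 'v monomial"
  assumes disj: "\<And>s t. s \<in> T \<Longrightarrow> t \<in> T \<Longrightarrow> s \<noteq> t \<Longrightarrow> Poly_Mapping.keys (M s) \<inter> Poly_Mapping.keys (M t) = {}"
    and fin: "finite T"
  shows "coefficient_ring.weakly_regular (carrier (mpoly_ring V :: ('v, 'k::field) mpoly ring))
     (\<lambda>s. Poly_Mapping.single (M s) 1) T"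
proof -
  interpret coefficient_ring "carrier (mpoly_ring V :: ('v, 'k) mpoly ring)"
    by (rule coefficient_ring_mpoly_ring)
  show ?thesis unfolding weakly_regular_def
  proof (intro allI impI)
    fix T' a r and c :: "nat \<Rightarrow> ('v, 'k) mpoly"
    assume T': "T' \<subseteq> T" and a: "a \<in> T - T'" and r: "r \<in> carrier (mpoly_ring V)"
      and eq: "Poly_Mapping.single (M a) 1 * r = (\<Sum>s\<in>T'. Poly_Mapping.single (M s) 1 * c s)"
    show "\<exists>c'. (\<forall>s. c' s \<in> carrier (mpoly_ring V)) \<and>
        r = (\<Sum>s\<in>T'. Poly_Mapping.single (M s) 1 * c' s)"
    proof (rule mem_monomial_ideal[OF r])
      show "finite T'" using T' fin finite_subset by blast
      fix e assume "e \<in> Poly_Mapping.keys r"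
      then obtain s e' where s: "s \<in> T'" "M a + e = M s + e'"
        by (rule keys_of_monomial_combination[OF eq])
      have "Poly_Mapping.lookup (M s) v \<le> Poly_Mapping.lookup e v" for v
      proof (cases "v \<in> Poly_Mapping.keys (M s)")
        case True
        then have "v \<notin> Poly_Mapping.keys (M a)" using disj[of s a] s T' a by blast
        then show ?thesis using arg_cong[OF s(2), of "\<lambda>e. Poly_Mapping.lookup e v"]
          by (simp add: lookup_add in_keys_iff)
      qed (simp add: in_keys_iff)
      then show "\<exists>s\<in>T'. \<exists>r. e = M s + r" using s(1) monomial_divides by blast
    qed
  qed
qed

lemma keys_poly_diff:
  fixes p q :: "('v, 'k::field) mpoly"
  shows "Poly_Mapping.keys (p - q) \<subseteq> Poly_Mapping.keys p \<union> Poly_Mapping.keys q"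
  by (auto simp: in_keys_iff lookup_minus)

lemma keys_exchange_sign:
  fixes p :: "('v, 'k::field) mpoly"
  shows "Poly_Mapping.keys (exchange_sign \<tau> s * p) = Poly_Mapping.keys p"
proof -
  have "exchange_sign \<tau> s = (1 :: ('v, 'k) mpoly) \<or> exchange_sign \<tau> s = (- 1 :: ('v, 'k) mpoly)"
    unfolding exchange_sign_def by (cases "even (card {j \<in> \<tau>. s < j})") auto
  then show ?thesis by (auto simp: in_keys_iff)
qed

section \<open>Products of ideals with free modules\<close>

text \<open>A vector with all coordinates in \<open>I\<close> lies in \<open>I F\<close>, for a free module \<open>F\<close> of finite rank.\<close>

lemma mem_ideal_times_free_module:
  fixes g :: "'b \<Rightarrow> ('v, 'k::field) mpoly"
  assumes B: "finite B" and g: "g \<in> carrier (free_module (mpoly_ring V) B)" and I: "\<And>c. g c \<in> I"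
  shows "g \<in> ideal_times_module (mpoly_ring V) I (free_module (mpoly_ring V) B)"
  unfolding ideal_times_module_def
proof (rule InterI)
  let ?M = "free_module (mpoly_ring V) B :: (('v, 'k) mpoly, 'b \<Rightarrow> ('v, 'k) mpoly) module"
  fix N
  assume "N \<in> {N. submodule N (mpoly_ring V) ?M \<and> (\<forall>r\<in>I. \<forall>u\<in>carrier ?M. r \<odot>\<^bsub>?M\<^esub> u \<in> N)}"
  then have N: "submodule N (mpoly_ring V) ?M"
    and IN: "\<And>r u. r \<in> I \<Longrightarrow> u \<in> carrier ?M \<Longrightarrow> r \<odot>\<^bsub>?M\<^esub> u \<in> N"
    by auto
  have sg: "subgroup N (add_monoid ?M)" using N by (simp add: submodule_def)
  have add: "(\<lambda>c. u c + v c) \<in> N" if "u \<in> N" "v \<in> N" for u v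
    using subgroup.m_closed[OF sg that] by (simp add: free_module_def)
  have zero_mem: "(\<lambda>c. 0) \<in> N"
    using subgroup.one_closed[OF sg] by (simp add: free_module_def)
  have "(\<lambda>c. if c \<in> A then g c else 0) \<in> N" if "finite A" "A \<subseteq> B" for A
    using that
  proof (induction A rule: finite_induct)
    case empty
    then show ?case using zero_mem by simp
  next
    case (insert a A)
    let ?e = "\<lambda>c. if c = a then 1 else 0 :: ('v, 'k) mpoly"
    have "?e \<in> carrier ?M"
      using insert.prems by (auto simp: free_module_def carrier_mpoly_ring_iff)
    then have "g a \<odot>\<^bsub>?M\<^esub> ?e \<in> N" using IN[OF I] by blast
    then have "(\<lambda>c. g a * ?e c) \<in> N" by (simp add: free_module_def)
    then have "(\<lambda>c. g a * ?e c + (if c \<in> A then g c else 0)) \<in> N"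
      using insert by (intro add) auto
    also have "(\<lambda>c. g a * ?e c + (if c \<in> A then g c else 0)) = (\<lambda>c. if c \<in> insert a A then g c else 0)"
      using insert.hyps by (auto simp: fun_eq_iff)
    finally show ?case .
  qed
  from this[OF B subset_refl] have "(\<lambda>c. if c \<in> B then g c else 0) \<in> N" .
  also have "(\<lambda>c. if c \<in> B then g c else 0) = g"
    using g by (auto simp: free_module_def fun_eq_iff)
  finally show "g \<in> N" .
qed

section \<open>Minimal vertex covers of the graph\<close>

text \<open>The graph \<open>H\<close>, with the primes of the vertex names omitted.\<close>

locale ordered_very_well_covered =
  fixes V :: "'v set" and E :: "'v set set" and d :: nat and x y :: "nat \<Rightarrow> 'v"
  assumes graph: "simple_graph V E"
    and vwc: "very_well_covered V E"
    and V_eq: "V = x ` {1..d} \<union> y ` {1..d}" and card_V: "card V = 2 * d"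
    and y_independent: "independent_set V E (y ` {1..d})"
    and xy_edge: "i \<in> {1..d} \<Longrightarrow> {x i, y i} \<in> E"
    and xy_order: "i \<in> {1..d} \<Longrightarrow> j \<in> {1..d} \<Longrightarrow> {x i, y j} \<in> E \<Longrightarrow> i \<le> j"
begin

lemma finite_V: "finite V"
  using graph by (simp add: simple_graph_def)

lemma inj_x: "inj_on x {1..d}" and inj_y: "inj_on y {1..d}"
  and x_y_disjoint: "x ` {1..d} \<inter> y ` {1..d} = {}"
proof -
  have le: "card (x ` {1..d}) \<le> d" "card (y ` {1..d}) \<le> d"
    using card_image_le[of "{1..d}" x] card_image_le[of "{1..d}" y] by auto
  have "card (x ` {1..d}) + card (y ` {1..d}) = 2 * d + card (x ` {1..d} \<inter> y ` {1..d})"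
    using card_Un_Int[of "x ` {1..d}" "y ` {1..d}"] card_V V_eq by simp
  then have eq: "card (x ` {1..d}) = d" "card (y ` {1..d}) = d"
    and "card (x ` {1..d} \<inter> y ` {1..d}) = 0" using le by linarith+
  then show "x ` {1..d} \<inter> y ` {1..d} = {}" by simp
  show "inj_on x {1..d}" "inj_on y {1..d}"
    using eq by (auto intro: eq_card_imp_inj_on)
qed

lemma x_eq_iff: "i \<in> {1..d} \<Longrightarrow> j \<in> {1..d} \<Longrightarrow> x i = x j \<longleftrightarrow> i = j"
  and y_eq_iff: "i \<in> {1..d} \<Longrightarrow> j \<in> {1..d} \<Longrightarrow> y i = y j \<longleftrightarrow> i = j"
  and x_neq_y: "i \<in> {1..d} \<Longrightarrow> j \<in> {1..d} \<Longrightarrow> x i \<noteq> y j"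
  using inj_x inj_y x_y_disjoint by (auto simp: inj_on_eq_iff simp del: atLeastAtMost_iff)

text \<open>The candidate for a minimal vertex cover with \<open>D\<close> as its set of \<open>y\<close>-indices.  A minimal vertex
  cover has \<open>d\<close> elements and meets each of the \<open>d\<close> edges \<open>{x i, y i}\<close>, so it is of this form.\<close>

definition cover :: "nat set \<Rightarrow> 'v set" where
  "cover D = x ` ({1..d} - D) \<union> y ` D"

text \<open>The index sets of the minimal vertex covers.\<close>

definition cover_sets :: "nat set set" where
  "cover_sets = {D. D \<subseteq> {1..d} \<and> vertex_cover V E (cover D)}"

lemma x_in_cover: "D \<subseteq> {1..d} \<Longrightarrow> i \<in> {1..d} \<Longrightarrow> x i \<in> cover D \<longleftrightarrow> i \<notin> D"
  using x_neq_y x_eq_iff unfolding cover_def by blast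

lemma y_in_cover: "D \<subseteq> {1..d} \<Longrightarrow> i \<in> {1..d} \<Longrightarrow> y i \<in> cover D \<longleftrightarrow> i \<in> D"
  using x_neq_y[symmetric] y_eq_iff unfolding cover_def by blast

lemma cover_subset: "D \<subseteq> {1..d} \<Longrightarrow> cover D \<subseteq> V"
  by (auto simp: cover_def V_eq)

lemma cover_inject: "D \<subseteq> {1..d} \<Longrightarrow> D' \<subseteq> {1..d} \<Longrightarrow> cover D = cover D' \<longleftrightarrow> D = D'"
  using y_in_cover by (metis subset_antisym subset_iff)

lemma card_cover: "D \<subseteq> {1..d} \<Longrightarrow> card (cover D) = d"
proof -
  assume D: "D \<subseteq> {1..d}"
  then have fin: "finite D" using finite_subset by blast
  have "card (cover D) = card (x ` ({1..d} - D)) + card (y ` D)"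
    unfolding cover_def using D x_y_disjoint fin by (intro card_Un_disjoint) auto
  also have "card (x ` ({1..d} - D)) = card ({1..d} - D)"
    by (intro card_image inj_on_subset[OF inj_x]) auto
  also have "card (y ` D) = card D"
    by (intro card_image inj_on_subset[OF inj_y] D)
  also have "card ({1..d} - D) + card D = d"
    using D fin card_Diff_subset[OF fin D] card_mono[OF _ D] by simp
  finally show ?thesis .
qed

lemma edge_cases:
  assumes "e \<in> E"
  obtains (xx) i j where "i \<in> {1..d}" "j \<in> {1..d}" "e = {x i, x j}"
    | (xy) i j where "i \<in> {1..d}" "j \<in> {1..d}" "e = {x i, y j}"
proof -
  have "e \<subseteq> V" "card e = 2" using assms graph by (auto simp: simple_graph_def)
  then obtain a b where ab: "e = {a, b}" "a \<in> V" "b \<in> V" by (auto simp: card_2_iff)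
  have "\<not> {a, b} \<subseteq> y ` {1..d}" using y_independent assms ab by (auto simp: independent_set_def)
  then show thesis using ab xx xy unfolding V_eq by (auto simp: insert_commute simp del: atLeastAtMost_iff)
qed

text \<open>The index sets are the sets that contain no edge among the \<open>x i\<close> and are closed under the
  relation \<open>{x i, y j} \<in> E\<close>.  Both properties are inherited by intersections.\<close>

lemma cover_sets_iff:
  assumes "D \<subseteq> {1..d}"
  shows "D \<in> cover_sets \<longleftrightarrow> (\<forall>i\<in>D. \<forall>j\<in>D. {x i, x j} \<notin> E) \<and> (\<forall>i\<in>D. \<forall>j\<in>{1..d}. {x i, y j} \<in> E \<longrightarrow> j \<in> D)"
    (is "_ \<longleftrightarrow> ?R")
proof
  assume D: "D \<in> cover_sets"
  then have vc: "e \<inter> cover D \<noteq> {}" if "e \<in> E" for e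
    using that by (auto simp: cover_sets_def vertex_cover_def)
  show ?R
  proof (intro conjI ballI impI notI)
    fix i j assume "i \<in> D" "j \<in> D" "{x i, x j} \<in> E"
    then show False using vc[of "{x i, x j}"] x_in_cover[OF assms] assms by auto
  next
    fix i j assume "i \<in> D" "j \<in> {1..d}" "{x i, y j} \<in> E"
    then show "j \<in> D"
      using vc[of "{x i, y j}"] x_in_cover[OF assms, of i] y_in_cover[OF assms, of j] assms by auto
  qed
next
  assume R: ?R
  have "e \<inter> cover D \<noteq> {}" if "e \<in> E" for e
    using that
  proof (cases rule: edge_cases)
    case (xx i j)
    then show ?thesis using R that x_in_cover[OF assms] by auto
  next
    case (xy i j)
    then show ?thesis using R that x_in_cover[OF assms, of i] y_in_cover[OF assms, of j] by auto
  qed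
  then show "D \<in> cover_sets" using assms cover_subset by (auto simp: cover_sets_def vertex_cover_def)
qed

lemma cover_sets_subset: "D \<in> cover_sets \<Longrightarrow> D \<subseteq> {1..d}"
  by (simp add: cover_sets_def)

lemma cover_sets_Int:
  assumes "D \<in> cover_sets" "D' \<in> cover_sets"
  shows "D \<inter> D' \<in> cover_sets"
proof -
  have "D \<subseteq> {1..d}" "D' \<subseteq> {1..d}" "D \<inter> D' \<subseteq> {1..d}" using assms cover_sets_subset by auto
  then show ?thesis
    using assms cover_sets_iff[of D] cover_sets_iff[of D'] cover_sets_iff[of "D \<inter> D'"] by blast
qed

text \<open>The combinatorial core of exactness at \<open>F\<^sub>0\<close>.  The least element \<open>s\<close> of \<open>D - D'\<close> can be removed from
  \<open>D\<close>: an obstruction would be an edge \<open>{x i, y s}\<close> with \<open>i \<in> D\<close> and \<open>i < s\<close>; then \<open>i \<in> D'\<close>, and closedness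
  of \<open>D'\<close> gives \<open>s \<in> D'\<close>.\<close>

lemma exists_removable:
  assumes D: "D \<in> cover_sets" and D': "D' \<in> cover_sets" and "\<not> D \<subseteq> D'"
  obtains s where "s \<in> D" "D - {s} \<in> cover_sets" "s \<notin> D'"
proof -
  note sub = cover_sets_subset[OF D] cover_sets_subset[OF D']
  note iff = cover_sets_iff[OF sub(1)] cover_sets_iff[OF sub(2)]
  define s where "s = Min (D - D')"
  have fin: "finite (D - D')" using sub finite_subset by blast
  have "s \<in> D - D'" unfolding s_def using assms(3) fin by (intro Min_in) auto
  then have s: "s \<in> D" "s \<notin> D'" by auto
  have "D - {s} \<in> cover_sets"
  proof (subst cover_sets_iff, use sub in blast, intro conjI ballI impI)
    show "{x i, x j} \<notin> E" if "i \<in> D - {s}" "j \<in> D - {s}" for i j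
      using that D iff(1) by blast
    show "j \<in> D - {s}" if "i \<in> D - {s}" "j \<in> {1..d}" "{x i, y j} \<in> E" for i j
    proof -
      have "j \<in> D" using that D iff(1) by blast
      moreover have "j \<noteq> s"
      proof
        assume j: "j = s"
        have "i \<le> s" using xy_order[of i j] that sub j by auto
        then have "i < s" using that by auto
        then have "i \<notin> D - D'" using Min_le[OF fin, of i] by (metis s_def not_less)
        then have "i \<in> D'" using that by auto
        then have "s \<in> D'" using that D' iff(2) j by blast
        then show False using s by simp
      qed
      ultimately show ?thesis by simp
    qed
  qed
  then show thesis using that s by blast
qed

lemma vertex_cover_superset:
  assumes "vertex_cover V E C"
  obtains D where "D \<in> cover_sets" "cover D \<subseteq> C"
proof -
  let ?S = "{C'. vertex_cover V E C' \<and> C' \<subseteq> C}"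
  have "finite C" using assms finite_V finite_subset by (auto simp: vertex_cover_def)
  then have "finite ?S" by (intro finite_subset[of ?S "Pow C"]) auto
  moreover have "?S \<noteq> {}" using assms by blast
  ultimately have "\<exists>M\<in>?S. \<forall>C'\<in>?S. C' \<subseteq> M \<longrightarrow> M = C'"
    by (rule finite_has_minimal)
  then obtain M where M: "M \<in> ?S" "\<And>C'. C' \<in> ?S \<Longrightarrow> C' \<subseteq> M \<Longrightarrow> C' = M"
    by metis
  have "M \<in> Min_covers V E" using M by (auto simp: Min_covers_def)
  then have cM: "card M = d" using vwc card_V by (auto simp: very_well_covered_def)
  define D where "D = {i \<in> {1..d}. y i \<in> M}"
  have D: "D \<subseteq> {1..d}" by (auto simp: D_def)
  have "x i \<in> M \<or> y i \<in> M" if "i \<in> {1..d}" for i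
    using M(1) xy_edge[OF that] by (auto simp: vertex_cover_def)
  then have "cover D \<subseteq> M" unfolding cover_def D_def by blast
  moreover have "finite M" using M(1) finite_V finite_subset by (auto simp: vertex_cover_def)
  ultimately have "cover D = M" using card_cover[OF D] cM by (intro card_subset_eq) auto
  then show thesis using that[of D] M(1) D by (auto simp: cover_sets_def)
qed

lemma Min_covers_eq: "Min_covers V E = cover ` cover_sets"
proof
  show "Min_covers V E \<subseteq> cover ` cover_sets"
  proof
    fix C assume C: "C \<in> Min_covers V E"
    then obtain D where "D \<in> cover_sets" "cover D \<subseteq> C"
      using vertex_cover_superset by (auto simp: Min_covers_def)
    then show "C \<in> cover ` cover_sets"
      using C by (auto simp: Min_covers_def cover_sets_def)
  qed
  show "cover ` cover_sets \<subseteq> Min_covers V E"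
  proof
    fix C assume "C \<in> cover ` cover_sets"
    then obtain D where D: "D \<in> cover_sets" "C = cover D" by blast
    have "C' = C" if C': "vertex_cover V E C'" "C' \<subseteq> C" for C'
    proof -
      obtain D' where D': "D' \<in> cover_sets" "cover D' \<subseteq> C'" using vertex_cover_superset C' by blast
      have "finite C" using D finite_V cover_subset[OF cover_sets_subset] finite_subset by blast
      moreover have "cover D' \<subseteq> C" using D' C' by blast
      ultimately have "cover D' = C" using D D' cover_sets_subset card_cover
        by (intro card_subset_eq) auto
      then show ?thesis using D' C' by blast
    qed
    then show "C \<in> Min_covers V E" using D by (auto simp: Min_covers_def cover_sets_def)
  qed
qed

lemma cover_exchange:
  assumes "D \<subseteq> {1..d}" "s \<in> D"
  shows "(cover D - {y s}) \<union> {x s} = cover (D - {s})"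
proof -
  have "{1..d} - (D - {s}) = insert s ({1..d} - D)" using assms by auto
  moreover have "y ` (D - {s}) = y ` D - {y s}" using assms y_eq_iff by blast
  moreover have "y s \<notin> x ` ({1..d} - D)" using assms x_neq_y by fastforce
  ultimately show ?thesis by (auto simp: cover_def)
qed

lemma swap_set_cover:
  assumes "D \<in> cover_sets"
  shows "swap_set V E d x y (cover D) = x ` {s \<in> D. D - {s} \<in> cover_sets}"
proof -
  note sub = cover_sets_subset[OF assms]
  have "(cover D - {y s}) \<union> {x s} \<in> Min_covers V E \<longleftrightarrow> D - {s} \<in> cover_sets" if "s \<in> D" for s
  proof -
    have "D - {s} \<subseteq> {1..d}" using sub by blast
    then show ?thesis
      unfolding cover_exchange[OF sub that] Min_covers_eq
      using cover_inject cover_sets_subset by blast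
  qed
  then show ?thesis unfolding swap_set_def using sub y_in_cover[OF sub] by blast
qed

end

section \<open>The complex in coordinates\<close>

text \<open>The parameter \<open>k\<close> only fixes the type of the coefficients.\<close>

locale expanded_very_well_covered = ordered_very_well_covered V E d x y
  for V :: "'v set" and E d x y +
  fixes n :: "nat \<Rightarrow> nat" and W :: "('v \<times> nat) set" and k :: "'k::field itself"
  assumes n_pos: "i \<in> {1..d} \<Longrightarrow> n i > 0"
    and W_eq: "W = expansion_vertices d x y n"
begin

abbreviation R :: "('v \<times> nat, 'k) mpoly ring" where
  "R \<equiv> mpoly_ring W"

abbreviation x_mono :: "nat \<Rightarrow> ('v \<times> nat, 'k) mpoly" where
  "x_mono s \<equiv> copies_product W (x s)"

abbreviation y_mono :: "nat \<Rightarrow> ('v \<times> nat, 'k) mpoly" where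
  "y_mono s \<equiv> copies_product W (y s)"

lemma finite_W: "finite W"
proof -
  have "W = (\<Union>i\<in>{1..d}. Pair (x i) ` {1..n i} \<union> Pair (y i) ` {1..n i})"
    unfolding W_eq expansion_vertices_def by (intro SUP_cong) auto
  then show ?thesis by simp
qed

lemma copy_in_W:
  assumes "v \<in> V"
  obtains j where "(v, j) \<in> W"
proof -
  have "(x i, 1) \<in> W" "(y i, 1) \<in> W" if "i \<in> {1..d}" for i
    using that n_pos[OF that] unfolding W_eq expansion_vertices_def by force+
  then show thesis using assms that by (auto simp: V_eq simp del: atLeastAtMost_iff)
qed

lemma lookup_copies_exponent:
  "Poly_Mapping.lookup (copies_exponent W v) w = (if w \<in> W \<and> fst w = v then 1 else 0)"
  using finite_W by (auto simp: copies_exponent_def lookup_sum lookup_single when_def)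

lemma keys_copies_exponent: "Poly_Mapping.keys (copies_exponent W v) = {w \<in> W. fst w = v}"
  by (auto simp: in_keys_iff lookup_copies_exponent split: if_splits)

lemma copies_product_eq:
  "copies_product W v = (Poly_Mapping.single (copies_exponent W v) 1 :: ('v \<times> nat, 'k) mpoly)"
  unfolding copies_product_def copies_exponent_def using finite_W by (intro prod_Var) simp

lemma copies_product_closed: "copies_product W v \<in> carrier R"
  unfolding copies_product_eq
  by (intro single_mem_mpoly_ring) (auto simp: keys_copies_exponent)

text \<open>The exponent vector of \<open>\<^bold>z\<^sub>C\<close>.\<close>

definition z_exponent :: "'v set \<Rightarrow> ('v \<times> nat) monomial" where
  "z_exponent C = (\<Sum>v\<in>C. copies_exponent W v)"

lemma z_monomial_eq:
  "finite C \<Longrightarrow> z_monomial W C = (Poly_Mapping.single (z_exponent C) 1 :: ('v \<times> nat, 'k) mpoly)"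
  unfolding z_monomial_def z_exponent_def
  by (induction C rule: finite_induct) (simp_all add: copies_product_eq mult_single)

lemma lookup_z_exponent:
  "finite C \<Longrightarrow> Poly_Mapping.lookup (z_exponent C) w = (if w \<in> W \<and> fst w \<in> C then 1 else 0)"
  by (auto simp: z_exponent_def lookup_sum lookup_copies_exponent)

lemma finite_cover: "D \<subseteq> {1..d} \<Longrightarrow> finite (cover D)"
  using cover_subset finite_V finite_subset by blast

sublocale exchange_complex "carrier R" d cover_sets x_mono y_mono
proof (intro exchange_complex.intro coefficient_ring_mpoly_ring exchange_complex_axioms.intro)
qed (use cover_sets_subset cover_sets_Int copies_product_closed in auto)

lemma weight_eq:
  assumes "D \<subseteq> {1..d}"
  shows "weight D = z_monomial W (cover D)"
proof -
  have fin: "finite D" using assms finite_subset by blast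
  have disj: "x ` ({1..d} - D) \<inter> y ` D = {}" using assms x_y_disjoint by blast
  have "inj_on x ({1..d} - D)" "inj_on y D"
    using inj_on_subset[OF inj_x] inj_on_subset[OF inj_y assms] by auto
  then show ?thesis
    unfolding z_monomial_def cover_def using disj fin
    by (subst prod.union_disjoint) (simp_all add: weight_def prod.reindex)
qed

lemma weakly_regular_x: "weakly_regular x_mono {1..d}"
  unfolding copies_product_eq
  by (rule weakly_regular_monomials) (auto simp: keys_copies_exponent x_eq_iff simp del: atLeastAtMost_iff)

text \<open>If \<open>e\<close> is a monomial with \<open>\<^bold>z\<^sub>D e\<close> divisible by \<open>\<^bold>z\<^sub>D\<^sub>'\<close> and \<open>D\<close> is not contained in \<open>D'\<close>, then there is
  an index \<open>s\<close> of \<open>removable D\<close> outside \<open>D'\<close>, and \<open>x'\<^sub>s\<close> divides \<open>\<^bold>z\<^sub>D\<^sub>'\<close> but is coprime to \<open>\<^bold>z\<^sub>D\<close>; so \<open>x'\<^sub>s\<close>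
  divides \<open>e\<close>.\<close>

lemma colon:
  assumes D: "D \<in> cover_sets" and u: "\<And>D'. u D' \<in> carrier R"
    and rel: "(\<Sum>D'\<in>cover_sets. u D' * weight D') = 0"
    and top: "\<And>D'. card D' > card D \<Longrightarrow> u D' = 0"
  shows "\<exists>c. (\<forall>s. c s \<in> carrier R) \<and> u D = (\<Sum>s\<in>removable D. x_mono s * c s)"
  unfolding copies_product_eq
proof (rule mem_monomial_ideal[OF u])
  show "finite (removable D)" using removable_subset[OF D] finite_subset by blast
  fix e assume e: "e \<in> Poly_Mapping.keys (u D)"
  let ?z = "\<lambda>D. z_exponent (cover D)"
  have w: "weight D' = Poly_Mapping.single (?z D') 1" if "D' \<in> cover_sets" for D'
    using cover_sets_subset[OF that] by (simp add: weight_eq z_monomial_eq finite_cover)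
  have "weight D * u D + (\<Sum>D'\<in>cover_sets - {D}. weight D' * u D') = 0"
    using rel sum.remove[OF finite_DD D, of "\<lambda>D'. u D' * weight D'"] by (simp add: mult.commute)
  then have "weight D * u D = - (\<Sum>D'\<in>cover_sets - {D}. weight D' * u D')"
    by (rule eq_neg_iff_add_eq_0[THEN iffD2])
  also have "\<dots> = (\<Sum>D'\<in>cover_sets - {D}. Poly_Mapping.single (?z D') 1 * - u D')"
    unfolding sum_negf[symmetric] by (intro sum.cong refl) (simp add: w)
  finally have "Poly_Mapping.single (?z D) 1 * u D =
      (\<Sum>D'\<in>cover_sets - {D}. Poly_Mapping.single (?z D') 1 * - u D')" by (simp add: w D)
  then obtain D' e' where D': "D' \<in> cover_sets - {D}" "e' \<in> Poly_Mapping.keys (- u D')"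
    "?z D + e = ?z D' + e'"
    using e by (rule keys_of_monomial_combination)
  have "card D' \<le> card D" using D'(2) top[of D'] by (cases "card D' > card D") auto
  moreover have "finite D'"
    using D'(1) cover_sets_subset[of D'] finite_subset[of D' "{1..d}"] by blast
  ultimately have "\<not> D \<subseteq> D'" using D'(1) card_seteq[of D' D] by auto
  then obtain s where s: "s \<in> D" "D - {s} \<in> cover_sets" "s \<notin> D'"
    using exists_removable[OF D] D'(1) by blast
  have sub: "D \<subseteq> {1..d}" "D' \<subseteq> {1..d}" using D D' cover_sets_subset by auto
  have sd: "s \<in> {1..d}" using s sub by blast
  have "Poly_Mapping.lookup (copies_exponent W (x s)) w \<le> Poly_Mapping.lookup e w" for w
  proof (cases "w \<in> W \<and> fst w = x s")
    case True
    then have "Poly_Mapping.lookup (?z D) w = 0" "Poly_Mapping.lookup (?z D') w = 1"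
      using x_in_cover[OF sub(1) sd] x_in_cover[OF sub(2) sd] s
        lookup_z_exponent[OF finite_cover[OF sub(1)], of w]
        lookup_z_exponent[OF finite_cover[OF sub(2)], of w] by simp_all
    then show ?thesis using True arg_cong[OF D'(3), of "\<lambda>e. Poly_Mapping.lookup e w"]
      by (simp add: lookup_add lookup_copies_exponent)
  qed (auto simp: lookup_copies_exponent)
  then show "\<exists>s\<in>removable D. \<exists>r. e = copies_exponent W (x s) + r"
    using s monomial_divides[of "copies_exponent W (x s)" e] by (auto simp: removable_def)
qed

text \<open>The translation between the basis symbols and the pairs of index sets, and between the
  corresponding coordinate functions.\<close>

definition encode :: "nat set \<Rightarrow> nat set \<Rightarrow> 'v set \<times> 'v set" where
  "encode D \<sigma> = (cover D, x ` \<sigma>)"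

definition pull :: "('v set \<times> 'v set \<Rightarrow> ('v \<times> nat, 'k) mpoly) \<Rightarrow> nat set \<Rightarrow> nat set \<Rightarrow> ('v \<times> nat, 'k) mpoly" where
  "pull f D \<sigma> = (if D \<subseteq> {1..d} \<and> \<sigma> \<subseteq> {1..d} then f (encode D \<sigma>) else 0)"

definition push :: "(nat set \<Rightarrow> nat set \<Rightarrow> ('v \<times> nat, 'k) mpoly) \<Rightarrow> 'v set \<times> 'v set \<Rightarrow> ('v \<times> nat, 'k) mpoly" where
  "push \<phi> c = (let D = {i \<in> {1..d}. y i \<in> fst c}; \<sigma> = {i \<in> {1..d}. x i \<in> snd c}
     in if c = encode D \<sigma> then \<phi> D \<sigma> else 0)"

lemma x_image_mem: "\<sigma> \<subseteq> {1..d} \<Longrightarrow> i \<in> {1..d} \<Longrightarrow> x i \<in> x ` \<sigma> \<longleftrightarrow> i \<in> \<sigma>"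
  using x_eq_iff by blast

lemma encode_inject:
  assumes "D \<subseteq> {1..d}" "\<sigma> \<subseteq> {1..d}" "D' \<subseteq> {1..d}" "\<sigma>' \<subseteq> {1..d}"
  shows "encode D \<sigma> = encode D' \<sigma>' \<longleftrightarrow> D = D' \<and> \<sigma> = \<sigma>'"
  using assms by (auto simp: encode_def cover_inject inj_on_image_eq_iff[OF inj_x])

lemma push_encode: "D \<subseteq> {1..d} \<Longrightarrow> \<sigma> \<subseteq> {1..d} \<Longrightarrow> push \<phi> (encode D \<sigma>) = \<phi> D \<sigma>"
proof -
  assume s: "D \<subseteq> {1..d}" "\<sigma> \<subseteq> {1..d}"
  have "{i \<in> {1..d}. y i \<in> cover D} = D" "{i \<in> {1..d}. x i \<in> x ` \<sigma>} = \<sigma>"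
    using y_in_cover[OF s(1)] x_image_mem[OF s(2)] s by blast+
  then show ?thesis by (simp add: push_def encode_def Let_def)
qed

abbreviation basis :: "nat \<Rightarrow> ('v set \<times> 'v set) set" where
  "basis \<equiv> res_basis V E d x y"

abbreviation F :: "nat \<Rightarrow> (('v \<times> nat, 'k) mpoly, 'v set \<times> 'v set \<Rightarrow> ('v \<times> nat, 'k) mpoly) module" where
  "F p \<equiv> free_module R (basis p)"

abbreviation differential :: "nat \<Rightarrow> ('v set \<times> 'v set \<Rightarrow> ('v \<times> nat, 'k) mpoly) \<Rightarrow> ('v set \<times> 'v set \<Rightarrow> ('v \<times> nat, 'k) mpoly)" where
  "differential \<equiv> res_diff V E W d x y"

abbreviation aug :: "('v set \<times> 'v set \<Rightarrow> ('v \<times> nat, 'k) mpoly) \<Rightarrow> ('v \<times> nat, 'k) mpoly" where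
  "aug \<equiv> res_aug V E W d x y"

lemma basis_eq: "basis p = case_prod encode ` cells p"
proof (rule equalityI; rule subsetI)
  fix c assume "c \<in> basis p"
  then obtain C \<sigma>' where c: "c = (C, \<sigma>')" "C \<in> Min_covers V E" "\<sigma>' \<subseteq> swap_set V E d x y C" "card \<sigma>' = p"
    by (auto simp: res_basis_def)
  then obtain D where D: "D \<in> cover_sets" "C = cover D" by (auto simp: Min_covers_eq)
  then have "\<sigma>' \<subseteq> x ` removable D" using c by (simp add: swap_set_cover removable_def)
  then obtain \<sigma> where \<sigma>: "\<sigma> \<subseteq> removable D" "\<sigma>' = x ` \<sigma>" by (auto simp: subset_image_iff)
  then have "\<sigma> \<subseteq> {1..d}" using removable_subset[OF D(1)] by blast
  then have "card \<sigma>' = card \<sigma>" unfolding \<sigma>(2) by (intro card_image inj_on_subset[OF inj_x])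
  then have "(D, \<sigma>) \<in> cells p" using D \<sigma> c by (simp add: cells_def)
  moreover have "c = case_prod encode (D, \<sigma>)" using c(1) D(2) \<sigma>(2) by (simp add: encode_def)
  ultimately show "c \<in> case_prod encode ` cells p" by (rule rev_image_eqI)
next
  fix c assume "c \<in> case_prod encode ` cells p"
  then obtain D \<sigma> where c: "(D, \<sigma>) \<in> cells p" "c = encode D \<sigma>" by auto
  note cd = cellsD[OF c(1)]
  have "card (x ` \<sigma>) = p" using cd by (simp add: card_image inj_on_subset[OF inj_x])
  moreover have "x ` \<sigma> \<subseteq> swap_set V E d x y (cover D)"
    unfolding swap_set_cover[OF cd(1)] using cd(3) by (auto simp: removable_def)
  ultimately show "c \<in> basis p" using cd c(2) by (auto simp: res_basis_def encode_def Min_covers_eq)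
qed

lemma encode_mem_basis:
  assumes "D \<subseteq> {1..d}" "\<sigma> \<subseteq> {1..d}"
  shows "encode D \<sigma> \<in> basis p \<longleftrightarrow> (D, \<sigma>) \<in> cells p"
proof
  assume "encode D \<sigma> \<in> basis p"
  then obtain D' \<sigma>' where *: "(D', \<sigma>') \<in> cells p" "encode D \<sigma> = encode D' \<sigma>'"
    by (auto simp: basis_eq)
  then have "D = D' \<and> \<sigma> = \<sigma>'" using encode_inject assms cellsD by metis
  then show "(D, \<sigma>) \<in> cells p" using * by simp
qed (auto simp: basis_eq)

lemma finite_cells: "finite (cells p)"
proof (rule finite_subset)
  show "cells p \<subseteq> Pow {1..d} \<times> Pow {1..d}" by (rule subsetI) (metis PowI SigmaI cellsD(2,5) surj_pair)
qed simp

lemma finite_basis: "finite (basis p)"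
  by (simp add: basis_eq finite_cells)

lemma carrier_F_iff: "f \<in> carrier (F p) \<longleftrightarrow> (\<forall>c. f c \<in> carrier R) \<and> (\<forall>c. c \<notin> basis p \<longrightarrow> f c = 0)"
proof -
  have "finite {c. f c \<noteq> 0}" if "\<forall>c. c \<notin> basis p \<longrightarrow> f c = 0"
    by (rule finite_subset[OF _ finite_basis[of p]]) (use that in blast)
  then show ?thesis by (auto simp: free_module_def)
qed

lemma carrier_FD:
  assumes "f \<in> carrier (F p)"
  shows "f c \<in> carrier R" "c \<notin> basis p \<Longrightarrow> f c = 0"
  using assms unfolding carrier_F_iff by blast+

lemma pull_mem:
  assumes "f \<in> carrier (F p)"
  shows "pull f \<in> chains p"
proof -
  have "pull f D \<sigma> = 0" if "(D, \<sigma>) \<notin> cells p" for D \<sigma>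
    using that encode_mem_basis[of D \<sigma> p] carrier_FD(2)[OF assms, of "encode D \<sigma>"] by (simp add: pull_def)
  moreover have "pull f D \<sigma> \<in> carrier R" for D \<sigma>
    using carrier_FD(1)[OF assms] by (simp add: pull_def)
  ultimately show ?thesis by (simp add: chains_def)
qed

lemma push_mem:
  assumes "\<phi> \<in> chains p"
  shows "push \<phi> \<in> carrier (F p)"
  unfolding carrier_F_iff
proof (intro conjI allI impI)
  fix c show "push \<phi> c \<in> carrier R" using chainsD(1)[OF assms] by (simp add: push_def Let_def)
  assume c: "c \<notin> basis p"
  then have "\<phi> D \<sigma> = 0" if "c = encode D \<sigma>" for D \<sigma>
    using that chainsD(2)[OF assms, of D \<sigma>] by (force simp: basis_eq)
  then show "push \<phi> c = 0" by (simp add: push_def Let_def)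
qed

lemma pull_push:
  assumes "\<phi> \<in> chains p"
  shows "pull (push \<phi>) = \<phi>"
proof (intro ext)
  fix D \<sigma>
  show "pull (push \<phi>) D \<sigma> = \<phi> D \<sigma>"
  proof (cases "D \<subseteq> {1..d} \<and> \<sigma> \<subseteq> {1..d}")
    case True
    then show ?thesis by (simp add: pull_def push_encode)
  next
    case False
    then have "(D, \<sigma>) \<notin> cells p" using cellsD by blast
    then show ?thesis using False chainsD(2)[OF assms] by (auto simp: pull_def)
  qed
qed

lemma pull_inject:
  assumes "f \<in> carrier (F p)" "g \<in> carrier (F p)" "pull f = pull g"
  shows "f = g"
proof
  fix c show "f c = g c"
  proof (cases "c \<in> basis p")
    case True
    then obtain D \<sigma> where c: "(D, \<sigma>) \<in> cells p" "c = encode D \<sigma>" by (auto simp: basis_eq)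
    then show ?thesis using fun_cong[OF fun_cong[OF assms(3), of D], of \<sigma>] cellsD[OF c(1)]
      by (simp add: pull_def)
  next
    case False
    then show ?thesis using carrier_FD(2)[OF assms(1)] carrier_FD(2)[OF assms(2)] by simp
  qed
qed

lemma res_diff_symbol_encode:
  assumes "(D, \<sigma>) \<in> cells p"
  shows "res_diff_symbol W d x y (encode D \<sigma>) c =
    (\<Sum>s\<in>\<sigma>. exchange_sign \<sigma> s *
      (y_mono s * (if c = encode (D - {s}) (\<sigma> - {s}) then 1 else 0) -
       x_mono s * (if c = encode D (\<sigma> - {s}) then 1 else 0)))"
proof -
  note cd = cellsD[OF assms]
  have 1: "{s \<in> {1..d}. x s \<in> x ` \<sigma>} = \<sigma>" using x_image_mem[OF cd(5)] cd(5) by blast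
  have 2: "alpha d x (x ` \<sigma>) s = card {j \<in> \<sigma>. s < j}" for s
  proof -
    have "{x j | j. j \<in> {1..d} \<and> x j \<in> x ` \<sigma> \<and> j > s} = x ` {j \<in> \<sigma>. s < j}"
      using x_image_mem[OF cd(5)] cd(5) by blast
    moreover have "inj_on x {j \<in> \<sigma>. s < j}" by (rule inj_on_subset[OF inj_x]) (use cd(5) in auto)
    ultimately show ?thesis by (simp add: alpha_def card_image)
  qed
  have 3: "x ` \<sigma> - {x s} = x ` (\<sigma> - {s})" if "s \<in> \<sigma>" for s
    using that cd(5) x_eq_iff by blast
  show ?thesis
    unfolding res_diff_symbol_def encode_def prod.case 1
  proof (intro sum.cong refl)
    fix s assume s: "s \<in> \<sigma>"
    then have "(cover D - {y s}) \<union> {x s} = cover (D - {s})" using cd by (intro cover_exchange) auto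
    then show "(- 1) ^ alpha d x (x ` \<sigma>) s *
        (y_mono s * res_symbol (cover D - {y s} \<union> {x s}) (x ` \<sigma> - {x s}) c -
         x_mono s * res_symbol (cover D) (x ` \<sigma> - {x s}) c) =
      exchange_sign \<sigma> s *
      (y_mono s * (if c = (cover (D - {s}), x ` (\<sigma> - {s})) then 1 else 0) -
       x_mono s * (if c = (cover D, x ` (\<sigma> - {s})) then 1 else 0))"
      by (simp only: 2 3[OF s] res_symbol_def exchange_sign_def)
  qed
qed

text \<open>The differential, given on basis symbols, in coordinates.\<close>

lemma res_diff_encode:
  assumes f: "f \<in> carrier (F p)" and D: "D \<subseteq> {1..d}" and \<tau>: "\<tau> \<subseteq> {1..d}"
  shows "differential p f (encode D \<tau>) = boundary (pull f) D \<tau>"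
proof -
  let ?\<phi> = "pull f"
  let ?t = "\<lambda>b s. ?\<phi> (fst b) (snd b) * (exchange_sign (snd b) s *
      (y_mono s * (if fst b - {s} = D \<and> snd b - {s} = \<tau> then 1 else 0) -
       x_mono s * (if fst b = D \<and> snd b - {s} = \<tau> then 1 else 0)))"
  have inj: "inj_on (case_prod encode) (cells p)"
    by (rule inj_onI) (use cellsD encode_inject in \<open>auto split: prod.splits\<close>)
  have "differential p f (encode D \<tau>) =
     (\<Sum>b\<in>cells p. f (case_prod encode b) * res_diff_symbol W d x y (case_prod encode b) (encode D \<tau>))"
    unfolding res_diff_def basis_eq by (subst sum.reindex[OF inj]) simp
  also have "\<dots> = (\<Sum>b\<in>cells p. \<Sum>s\<in>{1..d}. if s \<in> snd b then ?t b s else 0)"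
  proof (intro sum.cong refl)
    fix b assume "b \<in> cells p"
    then obtain D' \<sigma> where b: "b = (D', \<sigma>)" "(D', \<sigma>) \<in> cells p" by (cases b) auto
    note cd = cellsD[OF b(2)]
    have fb: "f (encode D' \<sigma>) = ?\<phi> D' \<sigma>" using cd by (simp add: pull_def)
    have "(\<Sum>s\<in>{1..d}. if s \<in> \<sigma> then ?t b s else 0) = (\<Sum>s\<in>{1..d} \<inter> \<sigma>. ?t b s)"
      by (rule sum.inter_restrict[symmetric]) simp
    also have "{1..d} \<inter> \<sigma> = \<sigma>" using cd by blast
    also have "(\<Sum>s\<in>\<sigma>. ?t b s) = f (encode D' \<sigma>) * res_diff_symbol W d x y (encode D' \<sigma>) (encode D \<tau>)"
      unfolding res_diff_symbol_encode[OF b(2)] sum_distrib_left fb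
    proof (intro sum.cong refl)
      fix s assume "s \<in> \<sigma>"
      have "D' - {s} \<subseteq> {1..d}" "\<sigma> - {s} \<subseteq> {1..d}" using cd by auto
      then have "(encode D \<tau> = encode (D' - {s}) (\<sigma> - {s})) = (D' - {s} = D \<and> \<sigma> - {s} = \<tau>)"
        "(encode D \<tau> = encode D' (\<sigma> - {s})) = (D' = D \<and> \<sigma> - {s} = \<tau>)"
        using encode_inject[OF D \<tau>] cd(2) by blast+
      then show "?t b s = ?\<phi> D' \<sigma> * (exchange_sign \<sigma> s *
        (y_mono s * (if encode D \<tau> = encode (D' - {s}) (\<sigma> - {s}) then 1 else 0) -
         x_mono s * (if encode D \<tau> = encode D' (\<sigma> - {s}) then 1 else 0)))"
        by (simp only: b fst_conv snd_conv)
    qed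
    finally show "f (case_prod encode b) * res_diff_symbol W d x y (case_prod encode b) (encode D \<tau>) =
       (\<Sum>s\<in>{1..d}. if s \<in> snd b then ?t b s else 0)" by (simp only: b prod.case snd_conv)
  qed
  also have "\<dots> = (\<Sum>s\<in>{1..d}. \<Sum>b\<in>cells p. if s \<in> snd b then ?t b s else 0)"
    by (rule sum.swap)
  also have "\<dots> = (\<Sum>s\<in>{1..d}. if s \<in> \<tau> then 0 else exchange_sign \<tau> s * transport s ?\<phi> D (insert s \<tau>))"
  proof (rule sum.cong[OF refl])
    fix s assume s: "s \<in> {1..d}"
    show "(\<Sum>b\<in>cells p. if s \<in> snd b then ?t b s else 0) =
      (if s \<in> \<tau> then 0 else exchange_sign \<tau> s * transport s ?\<phi> D (insert s \<tau>))"
    proof (cases "s \<in> \<tau>")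
      case True
      then have "\<sigma> - {s} \<noteq> \<tau>" for \<sigma> by auto
      then show ?thesis using True by (simp cong: if_cong)
    next
      case False
      have fin\<tau>: "finite \<tau>" using \<tau> finite_subset by blast
      let ?b1 = "(insert s D, insert s \<tau>)" and ?b2 = "(D, insert s \<tau>)"
      let ?g1 = "if s \<in> D then 0 else exchange_sign \<tau> s * (y_mono s * ?\<phi> (insert s D) (insert s \<tau>))"
      let ?g2 = "exchange_sign \<tau> s * (x_mono s * ?\<phi> D (insert s \<tau>))"
      have sg: "exchange_sign (insert s \<tau>) s = (exchange_sign \<tau> s :: ('v \<times> nat, 'k) mpoly)"
        using exchange_sign_insert[OF fin\<tau> False, of s] by simp
      have term_eq: "(if s \<in> snd b then ?t b s else 0) =
          (if b = ?b1 then ?g1 else 0) - (if b = ?b2 then ?g2 else 0)" if "b \<in> cells p" for b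
      proof -
        obtain D' \<sigma> where b: "b = (D', \<sigma>)" "(D', \<sigma>) \<in> cells p" using \<open>b \<in> cells p\<close> by (cases b) auto
        have sD: "\<sigma> \<subseteq> D'" using cellsD[OF b(2)] by blast
        have i1: "s \<in> \<sigma> \<and> D' - {s} = D \<and> \<sigma> - {s} = \<tau> \<longleftrightarrow> b = ?b1 \<and> s \<notin> D"
          using sD False b by auto
        have i2: "s \<in> \<sigma> \<and> D' = D \<and> \<sigma> - {s} = \<tau> \<longleftrightarrow> b = ?b2"
          using sD False b by auto
        have "(if s \<in> snd b then ?t b s else 0) =
          (if s \<in> \<sigma> \<and> D' - {s} = D \<and> \<sigma> - {s} = \<tau> then ?\<phi> D' \<sigma> * (exchange_sign \<sigma> s * y_mono s) else 0) -
          (if s \<in> \<sigma> \<and> D' = D \<and> \<sigma> - {s} = \<tau> then ?\<phi> D' \<sigma> * (exchange_sign \<sigma> s * x_mono s) else 0)"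
          by (simp add: b(1) algebra_simps)
        also have "\<dots> = (if b = ?b1 then ?g1 else 0) - (if b = ?b2 then ?g2 else 0)"
          unfolding i1 i2 using b(1) sg by (auto simp: mult_ac)
        finally show ?thesis .
      qed
      have ch: "?\<phi> \<in> chains p" by (rule pull_mem[OF f])
      have "(\<Sum>b\<in>cells p. if s \<in> snd b then ?t b s else 0) =
          (\<Sum>b\<in>cells p. (if b = ?b1 then ?g1 else 0)) - (\<Sum>b\<in>cells p. (if b = ?b2 then ?g2 else 0))"
        unfolding sum_subtractf[symmetric] by (intro sum.cong refl term_eq)
      also have "(\<Sum>b\<in>cells p. (if b = ?b1 then ?g1 else 0)) = ?g1"
        using finite_cells chainsD(2)[OF ch, of "insert s D" "insert s \<tau>"] by (simp add: sum.delta)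
      also have "(\<Sum>b\<in>cells p. (if b = ?b2 then ?g2 else 0)) = ?g2"
        using finite_cells chainsD(2)[OF ch, of D "insert s \<tau>"] by (simp add: sum.delta)
      finally show ?thesis using False by (simp add: transport_def algebra_simps)
    qed
  qed
  also have "\<dots> = boundary ?\<phi> D \<tau>"
    unfolding boundary_def by (rule sum.mono_neutral_cong_right) auto
  finally show ?thesis .
qed

lemma res_diff_outside:
  assumes "\<And>D \<tau>. D \<subseteq> {1..d} \<Longrightarrow> \<tau> \<subseteq> {1..d} \<Longrightarrow> c \<noteq> encode D \<tau>"
  shows "differential p f c = 0"
  unfolding res_diff_def
proof (intro sum.neutral ballI)
  fix b assume "b \<in> basis p"
  then obtain D \<sigma> where b: "b = encode D \<sigma>" "(D, \<sigma>) \<in> cells p" by (auto simp: basis_eq)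
  note cd = cellsD[OF b(2)]
  have "c \<noteq> encode (D - {s}) (\<sigma> - {s})" "c \<noteq> encode D (\<sigma> - {s})" for s
  proof -
    have "D - {s} \<subseteq> {1..d}" "\<sigma> - {s} \<subseteq> {1..d}" using cd(2,5) by auto
    then show "c \<noteq> encode (D - {s}) (\<sigma> - {s})" "c \<noteq> encode D (\<sigma> - {s})"
      using cd(2) by (simp_all only: assms not_False_eq_True)
  qed
  then show "f b * res_diff_symbol W d x y b c = 0"
    unfolding b(1) res_diff_symbol_encode[OF b(2)] by simp
qed

lemma
  assumes f: "f \<in> carrier (F (Suc p))"
  shows res_diff_mem: "differential (Suc p) f \<in> carrier (F p)"
    and pull_res_diff: "pull (differential (Suc p) f) = boundary (pull f)"
proof -
  have ch: "boundary (pull f) \<in> chains p" by (rule boundary_closed[OF pull_mem[OF f]])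
  show "differential (Suc p) f \<in> carrier (F p)"
    unfolding carrier_F_iff
  proof (rule conjI; rule allI)
    fix c
    have "differential (Suc p) f c \<in> carrier R \<and> (c \<notin> basis p \<longrightarrow> differential (Suc p) f c = 0)"
    proof (cases "\<exists>D \<tau>. D \<subseteq> {1..d} \<and> \<tau> \<subseteq> {1..d} \<and> c = encode D \<tau>")
      case True
      then show ?thesis
        using res_diff_encode[OF f] chainsD[OF ch] encode_mem_basis by auto
    next
      case False
      then have "differential (Suc p) f c = 0" by (intro res_diff_outside) blast
      then show ?thesis by simp
    qed
    then show "differential (Suc p) f c \<in> carrier R" "c \<notin> basis p \<longrightarrow> differential (Suc p) f c = 0" by blast+
  qed
  show "pull (differential (Suc p) f) = boundary (pull f)"
  proof (intro ext)
    fix D \<tau>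
    have "(D, \<tau>) \<notin> cells p" if "\<not> (D \<subseteq> {1..d} \<and> \<tau> \<subseteq> {1..d})" using that cellsD by blast
    then show "pull (differential (Suc p) f) D \<tau> = boundary (pull f) D \<tau>"
      using res_diff_encode[OF f, of D \<tau>] chainsD(2)[OF ch, of D \<tau>] by (auto simp: pull_def)
  qed
qed

lemma res_aug_eq: "aug f = augment (pull f)"
proof -
  have c0: "cells 0 = (\<lambda>D. (D, {})) ` cover_sets"
  proof -
    have *: "(D, \<sigma>) \<in> cells 0 \<longleftrightarrow> D \<in> cover_sets \<and> \<sigma> = {}" for D \<sigma>
    proof
      assume c: "(D, \<sigma>) \<in> cells 0"
      show "D \<in> cover_sets \<and> \<sigma> = {}" using cellsD(1,6,7)[OF c] by simp
    qed (simp add: cells_def)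
    show ?thesis
    proof (rule equalityI; rule subsetI)
      fix b assume "b \<in> cells 0"
      then show "b \<in> (\<lambda>D. (D, {})) ` cover_sets" by (cases b) (simp only: *, blast)
    next
      fix b :: "nat set \<times> nat set"
      assume "b \<in> (\<lambda>D. (D, {})) ` cover_sets"
      then obtain D where "D \<in> cover_sets" "b = (D, {})" by blast
      then show "b \<in> cells 0" by (simp only: *)
    qed
  qed
  have b0: "basis 0 = (\<lambda>D. encode D {}) ` cover_sets"
    unfolding basis_eq c0 image_image by simp
  have "inj_on (\<lambda>D. encode D {}) cover_sets"
    using cover_sets_subset encode_inject by (intro inj_onI) auto
  then have "aug f = (\<Sum>D\<in>cover_sets. f (encode D {}) * z_monomial W (fst (encode D {})))"
    unfolding res_aug_def b0 by (simp add: sum.reindex)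
  also have "\<dots> = augment (pull f)"
    unfolding augment_def using cover_sets_subset
    by (intro sum.cong refl) (simp add: pull_def encode_def weight_eq)
  finally show ?thesis .
qed

end

section \<open>The cover ideal of the expanded graph\<close>

context expanded_very_well_covered
begin

abbreviation J :: "('v \<times> nat, 'k) mpoly set" where
  "J \<equiv> cover_ideal W (expansion_edges W E)"

lemma Var_closed: "w \<in> W \<Longrightarrow> Var w \<in> carrier R"
  unfolding Var_def by (rule single_mem_mpoly_ring) simp

lemma prod_Var_closed: "A \<subseteq> W \<Longrightarrow> (\<Prod>w\<in>A. Var w) \<in> carrier R"
  using Var_closed by (intro prod_closed) auto

lemma ideal_J: "ideal J R"
proof -
  interpret cring R by (rule cring_mpoly_ring)
  show ?thesis unfolding cover_ideal_def
    using prod_Var_closed by (intro genideal_ideal) (auto simp: vertex_cover_def)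
qed

lemma ideal_sum_closed:
  assumes I: "ideal I R" and g: "\<And>i. i \<in> A \<Longrightarrow> g i \<in> I"
  shows "sum g A \<in> I"
proof -
  note ag = ideal.axioms(1)[OF I]
  have z: "0 \<in> I" using additive_subgroup.zero_closed[OF ag] by simp
  have a: "p + q \<in> I" if "p \<in> I" "q \<in> I" for p q
    using additive_subgroup.a_closed[OF ag that] by simp
  show ?thesis using g
    by (induction A rule: infinite_finite_induct) (auto intro: z a)
qed

lemma ideal_uminus_closed:
  assumes I: "ideal I R" and a: "a \<in> I"
  shows "- a \<in> I"
proof -
  have "- 1 \<in> carrier R" by (intro uminus_closed one_closed)
  then have "(- 1) * a \<in> I" using ideal.I_l_closed[OF I a, of "- 1"] by simp
  then show ?thesis by simp
qed

lemma ideal_mult_closed: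
  assumes I: "ideal I R" and a: "a \<in> I" and r: "r \<in> carrier R"
  shows "r * a \<in> I" "a * r \<in> I"
  using ideal.I_l_closed[OF I a r] ideal.I_r_closed[OF I a r] by simp_all

lemma z_monomial_eq_prod_Var:
  assumes "finite C"
  shows "z_monomial W C = (\<Prod>w\<in>{w \<in> W. fst w \<in> C}. Var w :: ('v \<times> nat, 'k) mpoly)"
proof -
  have "{w \<in> W. fst w \<in> C} = (\<Union>v\<in>C. {w \<in> W. fst w = v})" by auto
  then show ?thesis unfolding z_monomial_def copies_product_def
    using assms finite_W by (subst prod.UNION_disjoint[symmetric]) auto
qed

lemma weight_mem_J:
  assumes D: "D \<in> cover_sets"
  shows "weight D \<in> J"
proof -
  interpret cring R by (rule cring_mpoly_ring)
  have sub: "D \<subseteq> {1..d}" by (rule cover_sets_subset[OF D])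
  let ?C = "{w \<in> W. fst w \<in> cover D}"
  have "vertex_cover W (expansion_edges W E) ?C"
    unfolding vertex_cover_def
  proof (intro conjI ballI)
    fix e assume "e \<in> expansion_edges W E"
    then obtain a b where ab: "e = {a, b}" "a \<in> W" "b \<in> W" "{fst a, fst b} \<in> E"
      by (auto simp: expansion_edges_def)
    then have "{fst a, fst b} \<inter> cover D \<noteq> {}" using D unfolding cover_sets_def vertex_cover_def by blast
    then show "e \<inter> ?C \<noteq> {}" using ab by auto
  qed auto
  then have "(\<Prod>w\<in>?C. Var w) \<in> {\<Prod>v\<in>C. Var v | C. vertex_cover W (expansion_edges W E) C}" by blast
  moreover have "{\<Prod>v\<in>C. Var v | C. vertex_cover W (expansion_edges W E) C} \<subseteq> carrier R"
    using prod_Var_closed by (auto simp: vertex_cover_def)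
  ultimately have "(\<Prod>w\<in>?C. Var w) \<in> J"
    unfolding cover_ideal_def using genideal_self by blast
  then show ?thesis by (simp only: weight_eq[OF sub] z_monomial_eq_prod_Var[OF finite_cover[OF sub]])
qed

text \<open>The ideal generated by the monomials \<open>\<^bold>z\<^sub>C\<close> of the minimal vertex covers \<open>C\<close> of \<open>H\<close>.\<close>

definition weight_span :: "('v \<times> nat, 'k) mpoly set" where
  "weight_span = {p. \<exists>u. (\<forall>D. u D \<in> carrier R) \<and> p = (\<Sum>D\<in>cover_sets. u D * weight D)}"

lemma weight_closed: "D \<in> cover_sets \<Longrightarrow> weight D \<in> carrier R"
  using weight_mem_J ideal.Icarr[OF ideal_J] by blast

lemma weight_spanI: "(\<And>D. u D \<in> carrier R) \<Longrightarrow> (\<Sum>D\<in>cover_sets. u D * weight D) \<in> weight_span"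
  unfolding weight_span_def by blast

lemma ideal_weight_span: "ideal weight_span R"
proof -
  interpret R: cring R by (rule cring_mpoly_ring)
  have smult: "r * p \<in> weight_span" if "p \<in> weight_span" "r \<in> carrier R" for p r
  proof -
    obtain u where u: "\<And>D. u D \<in> carrier R" "p = (\<Sum>D\<in>cover_sets. u D * weight D)"
      using \<open>p \<in> weight_span\<close> unfolding weight_span_def by blast
    have "r * p = (\<Sum>D\<in>cover_sets. (r * u D) * weight D)"
      by (simp add: u(2) sum_distrib_left mult.assoc)
    then show ?thesis using weight_spanI[of "\<lambda>D. r * u D"] u(1) that(2) mult_closed by simp
  qed
  have minus: "\<ominus>\<^bsub>R\<^esub> p = - p" if "p \<in> carrier R" for p
    using that by (intro R.minus_equality) (auto intro: uminus_closed)
  have sub: "weight_span \<subseteq> carrier R"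
    unfolding weight_span_def by (auto intro!: sum_closed mult_closed weight_closed)
  show ?thesis
  proof (rule idealI)
    show "ring R" by (rule R.ring_axioms)
    show "subgroup weight_span (add_monoid R)"
    proof (rule R.add.subgroupI)
      show "weight_span \<noteq> {}" using weight_spanI[of "\<lambda>D. 0"] by auto
      fix p assume p: "p \<in> weight_span"
      then show "\<ominus>\<^bsub>R\<^esub> p \<in> weight_span"
        using smult[OF p, of "- 1"] minus[of p] sub uminus_closed[of 1] by auto
      fix q assume q: "q \<in> weight_span"
      obtain u v where uv: "\<And>D. u D \<in> carrier R" "p = (\<Sum>D\<in>cover_sets. u D * weight D)"
        "\<And>D. v D \<in> carrier R" "q = (\<Sum>D\<in>cover_sets. v D * weight D)"
        using p q unfolding weight_span_def by blast
      have "p + q = (\<Sum>D\<in>cover_sets. (u D + v D) * weight D)"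
        by (simp add: uv(2,4) sum.distrib algebra_simps)
      then show "p \<oplus>\<^bsub>R\<^esub> q \<in> weight_span"
        using weight_spanI[of "\<lambda>D. u D + v D"] uv(1,3) add_closed by simp
    qed (use sub in auto)
  qed (use smult in \<open>auto simp: mult.commute\<close>)
qed

text \<open>Given a vertex cover of \<open>G\<close>, the vertices of \<open>H\<close> all of whose copies it contains form a vertex
  cover of \<open>H\<close>.  Hence the monomials of the minimal covers of \<open>H\<close> generate the cover ideal of \<open>G\<close>.\<close>

lemma J_eq: "J = weight_span"
proof
  interpret cring R by (rule cring_mpoly_ring)
  show "weight_span \<subseteq> J"
    unfolding weight_span_def
    by (auto intro!: ideal_sum_closed[OF ideal_J] ideal_mult_closed(1)[OF ideal_J weight_mem_J])
  show "J \<subseteq> weight_span"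
    unfolding cover_ideal_def
  proof (rule genideal_minimal[OF ideal_weight_span], rule subsetI)
    fix p :: "('v \<times> nat, 'k) mpoly"
    assume "p \<in> {\<Prod>v\<in>C. Var v | C. vertex_cover W (expansion_edges W E) C}"
    then obtain C where C: "vertex_cover W (expansion_edges W E) C" "p = (\<Prod>w\<in>C. Var w)" by blast
    let ?U = "{v \<in> V. \<forall>j. (v, j) \<in> W \<longrightarrow> (v, j) \<in> C}"
    have "vertex_cover V E ?U"
      unfolding vertex_cover_def
    proof (intro conjI ballI notI)
      fix e assume e: "e \<in> E" and none: "e \<inter> ?U = {}"
      have "e \<subseteq> V" "card e = 2" using e graph by (auto simp: simple_graph_def)
      then obtain a b where ab: "e = {a, b}" "a \<in> V" "b \<in> V" by (auto simp: card_2_iff)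
      then obtain i j where "(a, i) \<in> W" "(a, i) \<notin> C" "(b, j) \<in> W" "(b, j) \<notin> C" using none by blast
      moreover from this have "{(a, i), (b, j)} \<in> expansion_edges W E"
        using e ab unfolding expansion_edges_def by force
      ultimately show False using C(1) by (auto simp: vertex_cover_def)
    qed auto
    then obtain D where D: "D \<in> cover_sets" "cover D \<subseteq> ?U" by (rule vertex_cover_superset)
    let ?A = "{w \<in> W. fst w \<in> cover D}"
    have CW: "C \<subseteq> W" using C(1) by (simp add: vertex_cover_def)
    have "?A \<subseteq> C" using D(2) by auto
    moreover have "finite C" using CW finite_W finite_subset by blast
    ultimately have "p = (\<Prod>w\<in>C - ?A. Var w) * (\<Prod>w\<in>?A. Var w)"
      unfolding C(2) by (rule prod.subset_diff)
    also have "(\<Prod>w\<in>?A. Var w) = weight D"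
      using cover_sets_subset[OF D(1)]
      by (simp only: weight_eq z_monomial_eq_prod_Var finite_cover)
    also have "(\<Prod>w\<in>C - ?A. Var w) * weight D =
        (\<Sum>D'\<in>cover_sets. (if D' = D then \<Prod>w\<in>C - ?A. Var w else 0) * weight D')"
      using D(1) finite_DD by (simp add: if_distrib[of "\<lambda>a. a * _"] sum.delta cong: if_cong)
    also have "\<dots> \<in> weight_span"
    proof (rule weight_spanI)
      have "(\<Prod>w\<in>C - ?A. Var w) \<in> carrier R" using CW by (intro prod_Var_closed) blast
      then show "(if D' = D then \<Prod>w\<in>C - ?A. Var w else 0) \<in> carrier R" for D' by simp
    qed
    finally show "p \<in> weight_span" .
  qed
qed

lemma aug_mem: "f \<in> carrier (F 0) \<Longrightarrow> aug f \<in> J"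
  unfolding res_aug_eq augment_def J_eq
  by (rule weight_spanI) (rule chainsD(1)[OF pull_mem])

lemma aug_image: "aug ` carrier (F 0) = J"
proof
  show "aug ` carrier (F 0) \<subseteq> J" using aug_mem by blast
  show "J \<subseteq> aug ` carrier (F 0)"
  proof
    fix p assume "p \<in> J"
    then obtain u where u: "\<And>D. u D \<in> carrier R" "p = (\<Sum>D\<in>cover_sets. u D * weight D)"
      unfolding J_eq weight_span_def by blast
    define \<phi> where "\<phi> D \<sigma> = (if (D, \<sigma>) \<in> cells 0 then u D else 0)" for D \<sigma>
    have ch: "\<phi> \<in> chains 0" using u(1) by (simp add: chains_def \<phi>_def)
    have "aug (push \<phi>) = p"
      unfolding res_aug_eq pull_push[OF ch] augment_def u(2)
      by (intro sum.cong refl) (simp add: \<phi>_def cells_def)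
    then show "p \<in> aug ` carrier (F 0)" using push_mem[OF ch] by blast
  qed
qed

section \<open>Exactness of the complex\<close>

lemma pull_eq_0_iff: "f \<in> carrier (F p) \<Longrightarrow> pull f = (\<lambda>D \<sigma>. 0) \<longleftrightarrow> f = (\<lambda>c. 0)"
proof -
  assume f: "f \<in> carrier (F p)"
  have "(\<lambda>c. 0) \<in> carrier (F p)" by (simp add: carrier_F_iff)
  moreover have "pull (\<lambda>c. 0) = (\<lambda>D \<sigma>. 0)" by (simp add: pull_def fun_eq_iff)
  ultimately show ?thesis using pull_inject[OF f, of "\<lambda>c. 0"] by auto
qed

lemma lift_boundary:
  assumes f: "f \<in> carrier (F p)" and "\<exists>\<psi>\<in>chains (Suc p). boundary \<psi> = pull f"
  shows "f \<in> differential (Suc p) ` carrier (F (Suc p))"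
proof -
  obtain \<psi> where \<psi>: "\<psi> \<in> chains (Suc p)" "boundary \<psi> = pull f" using assms(2) by blast
  note g = push_mem[OF \<psi>(1)]
  have "pull (differential (Suc p) (push \<psi>)) = pull f"
    by (simp only: pull_res_diff[OF g] pull_push[OF \<psi>(1)] \<psi>(2))
  then have "differential (Suc p) (push \<psi>) = f" by (rule pull_inject[OF res_diff_mem[OF g] f])
  then show ?thesis using g by blast
qed

lemma exact_at_0: "differential 1 ` carrier (F 1) = map_kernel (F 0) (ideal_as_module R J) aug"
proof
  show "differential 1 ` carrier (F 1) \<subseteq> map_kernel (F 0) (ideal_as_module R J) aug"
  proof
    fix g assume "g \<in> differential 1 ` carrier (F 1)"
    then obtain f where f: "f \<in> carrier (F (Suc 0))" "g = differential (Suc 0) f" by auto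
    have "aug g = 0" unfolding res_aug_eq f(2) pull_res_diff[OF f(1)]
      using augment_boundary pull_mem[OF f(1)] by simp
    then show "g \<in> map_kernel (F 0) (ideal_as_module R J) aug"
      using res_diff_mem[OF f(1)] f(2) by (simp add: map_kernel_def ideal_as_module_def)
  qed
  show "map_kernel (F 0) (ideal_as_module R J) aug \<subseteq> differential 1 ` carrier (F 1)"
  proof
    fix f assume "f \<in> map_kernel (F 0) (ideal_as_module R J) aug"
    then have f: "f \<in> carrier (F 0)" "aug f = 0" by (auto simp: map_kernel_def ideal_as_module_def)
    have "\<exists>\<psi>\<in>chains 1. boundary \<psi> = pull f"
      using f(2) by (intro augment_exact colon pull_mem f(1)) (auto simp: res_aug_eq)
    then show "f \<in> differential 1 ` carrier (F 1)" using lift_boundary[OF f(1)] by simp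
  qed
qed

lemma exact_at_Suc:
  "differential (Suc (Suc p)) ` carrier (F (Suc (Suc p))) = map_kernel (F (Suc p)) (F p) (differential (Suc p))"
proof
  have z: "\<zero>\<^bsub>F q\<^esub> = (\<lambda>c. 0)" for q by (simp add: free_module_def)
  show "differential (Suc (Suc p)) ` carrier (F (Suc (Suc p))) \<subseteq> map_kernel (F (Suc p)) (F p) (differential (Suc p))"
  proof
    fix g assume "g \<in> differential (Suc (Suc p)) ` carrier (F (Suc (Suc p)))"
    then obtain f where f: "f \<in> carrier (F (Suc (Suc p)))" "g = differential (Suc (Suc p)) f" by auto
    have g: "g \<in> carrier (F (Suc p))" unfolding f(2) by (rule res_diff_mem[OF f(1)])
    have "pull (differential (Suc p) g) = (\<lambda>D \<sigma>. 0)"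
      unfolding pull_res_diff[OF g] unfolding f(2) pull_res_diff[OF f(1)]
      using boundary_boundary[OF pull_mem[OF f(1)]] by blast
    then have "differential (Suc p) g = (\<lambda>c. 0)" using pull_eq_0_iff[OF res_diff_mem[OF g]] by blast
    then show "g \<in> map_kernel (F (Suc p)) (F p) (differential (Suc p))"
      using g by (simp add: map_kernel_def z)
  qed
  show "map_kernel (F (Suc p)) (F p) (differential (Suc p)) \<subseteq> differential (Suc (Suc p)) ` carrier (F (Suc (Suc p)))"
  proof
    fix f assume "f \<in> map_kernel (F (Suc p)) (F p) (differential (Suc p))"
    then have f: "f \<in> carrier (F (Suc p))" "differential (Suc p) f = (\<lambda>c. 0)"
      by (auto simp: map_kernel_def z)
    have "boundary (pull f) = (\<lambda>D \<sigma>. 0)"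
      unfolding pull_res_diff[OF f(1), symmetric] using f pull_eq_0_iff[OF res_diff_mem[OF f(1)]] by blast
    then have "\<exists>\<psi>\<in>chains (Suc (Suc p)). boundary \<psi> = pull f"
      by (intro boundary_exact weakly_regular_x pull_mem f(1))
    then show "f \<in> differential (Suc (Suc p)) ` carrier (F (Suc (Suc p)))" by (rule lift_boundary[OF f(1)])
  qed
qed

section \<open>Linearity, multidegrees and minimality\<close>

lemma linear_aug: "linear_map R (F 0) (ideal_as_module R J) aug"
  unfolding linear_map_def
proof (intro conjI ballI)
  show "aug \<in> carrier (F 0) \<rightarrow> carrier (ideal_as_module R J)"
    using aug_mem by (auto simp: ideal_as_module_def)
qed (simp_all add: free_module_def ideal_as_module_def res_aug_def algebra_simps
    sum.distrib sum_distrib_left)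

lemma linear_differential: "linear_map R (F (Suc p)) (F p) (differential (Suc p))"
  unfolding linear_map_def
proof (intro conjI ballI)
  show "differential (Suc p) \<in> carrier (F (Suc p)) \<rightarrow> carrier (F p)"
    using res_diff_mem by auto
qed (simp_all add: free_module_def res_diff_def algebra_simps sum.distrib sum_distrib_left)

lemma res_degree_encode:
  "\<sigma> \<subseteq> {1..d} \<Longrightarrow> res_degree W (encode D \<sigma>) = z_exponent (cover D) + (\<Sum>s\<in>\<sigma>. copies_exponent W (x s))"
  by (simp add: res_degree_def encode_def z_exponent_def sum.reindex inj_on_subset[OF inj_x])

text \<open>Equivalently, \<open>\<^bold>f(C;\<sigma>)\<close> and \<open>y'\<^sub>s \<^bold>f((C - {y'\<^sub>s}) \<union> {x'\<^sub>s}; \<sigma> - {x'\<^sub>s})\<close> have the same multidegree.\<close>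

lemma z_exponent_exchange:
  assumes D: "D \<subseteq> {1..d}" and s: "s \<in> {1..d}" "s \<notin> D"
  shows "z_exponent (cover (insert s D)) + copies_exponent W (x s) =
    copies_exponent W (y s) + z_exponent (cover D)"
proof -
  let ?D = "insert s D"
  have sD: "?D \<subseteq> {1..d}" using D s by simp
  have "?D - {s} = D" using s by auto
  then have eq: "cover D = insert (x s) (cover ?D - {y s})"
    using cover_exchange[OF sD, of s] by simp
  have "y s \<in> cover ?D" "x s \<notin> cover ?D" using x_in_cover[OF sD s(1)] y_in_cover[OF sD s(1)] by auto
  moreover have "finite (cover ?D)" by (rule finite_cover[OF sD])
  ultimately show ?thesis
    unfolding eq z_exponent_def by (simp add: sum.remove[of "cover ?D" "y s"] add_ac)
qed

lemma degree_aug: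
  assumes f: "f \<in> free_component W (basis 0) (res_degree W) m"
  shows "aug f \<in> ideal_component J m"
proof -
  have fF: "f \<in> carrier (F 0)"
    and h: "\<And>b e. b \<in> basis 0 \<Longrightarrow> e \<in> Poly_Mapping.keys (f b) \<Longrightarrow> e + res_degree W b = m"
    using f by (auto simp: free_component_def)
  have "Poly_Mapping.keys (f b * z_monomial W (fst b)) \<subseteq> {m}" if b: "b \<in> basis 0" for b
  proof -
    obtain D \<sigma> where D: "b = encode D \<sigma>" "(D, \<sigma>) \<in> cells 0" using b by (auto simp: basis_eq)
    note cd = cellsD[OF D(2)]
    have \<sigma>: "\<sigma> = {}" using cd(6,7) by simp
    have "f b * z_monomial W (fst b) = Poly_Mapping.single (z_exponent (cover D)) 1 * f b"
      using z_monomial_eq[OF finite_cover[OF cd(2)]] by (simp add: D(1) encode_def mult.commute)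
    then show ?thesis
      using h[OF b] res_degree_encode[of "{}" D] by (auto simp: keys_monomial_mult D(1) \<sigma> add.commute)
  qed
  then have "Poly_Mapping.keys (aug f) \<subseteq> {m}"
    unfolding res_aug_def
    using keys_sum[of "\<lambda>b. f b * z_monomial W (fst b)" "basis 0"] by blast
  then show ?thesis using aug_mem[OF fF] by (simp add: ideal_component_def)
qed

lemma degree_differential:
  assumes f: "f \<in> free_component W (basis (Suc p)) (res_degree W) m"
  shows "differential (Suc p) f \<in> free_component W (basis p) (res_degree W) m"
proof -
  have fF: "f \<in> carrier (F (Suc p))"
    and h: "\<And>b e. b \<in> basis (Suc p) \<Longrightarrow> e \<in> Poly_Mapping.keys (f b) \<Longrightarrow> e + res_degree W b = m"
    using f by (auto simp: free_component_def)
  have hp: "e + (z_exponent (cover D) + (\<Sum>s\<in>\<sigma>. copies_exponent W (x s))) = m"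
    if "e \<in> Poly_Mapping.keys (pull f D \<sigma>)" for D \<sigma> e
  proof -
    have s: "D \<subseteq> {1..d}" "\<sigma> \<subseteq> {1..d}" "e \<in> Poly_Mapping.keys (f (encode D \<sigma>))"
      using that by (auto simp: pull_def split: if_splits)
    then have "encode D \<sigma> \<in> basis (Suc p)" using carrier_FD(2)[OF fF] by fastforce
    then show ?thesis using h[OF _ s(3)] res_degree_encode[OF s(2)] by simp
  qed
  have "e + res_degree W c = m"
    if c: "c \<in> basis p" and e: "e \<in> Poly_Mapping.keys (differential (Suc p) f c)" for c e
  proof -
    obtain D \<tau> where D: "c = encode D \<tau>" "(D, \<tau>) \<in> cells p" using c by (auto simp: basis_eq)
    note cd = cellsD[OF D(2)]
    have "e \<in> Poly_Mapping.keys (boundary (pull f) D \<tau>)"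
      using e res_diff_encode[OF fF cd(2,5)] by (simp add: D(1))
    then obtain s where s: "s \<in> {1..d} - \<tau>"
      and "e \<in> Poly_Mapping.keys (exchange_sign \<tau> s * transport s (pull f) D (insert s \<tau>))"
      unfolding boundary_def
      using keys_sum[of "\<lambda>s. exchange_sign \<tau> s * transport s (pull f) D (insert s \<tau>)" "{1..d} - \<tau>"]
      by blast
    then have et: "e \<in> Poly_Mapping.keys (transport s (pull f) D (insert s \<tau>))"
      by (simp only: keys_exchange_sign)
    have sum_ins: "(\<Sum>t\<in>insert s \<tau>. copies_exponent W (x t)) =
        copies_exponent W (x s) + (\<Sum>t\<in>\<tau>. copies_exponent W (x t))"
      using s cd(7) by simp
    have "e + (z_exponent (cover D) + (\<Sum>t\<in>\<tau>. copies_exponent W (x t))) = m"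
    proof (cases "e \<in> Poly_Mapping.keys (x_mono s * pull f D (insert s \<tau>))")
      case True
      then obtain e' where e': "e' \<in> Poly_Mapping.keys (pull f D (insert s \<tau>))"
        "e = copies_exponent W (x s) + e'"
        by (auto simp: copies_product_eq keys_monomial_mult)
      then show ?thesis using hp[OF e'(1)] by (simp add: sum_ins add_ac)
    next
      case False
      then have sD: "s \<notin> D" and "e \<in> Poly_Mapping.keys (y_mono s * pull f (insert s D) (insert s \<tau>))"
        using et keys_poly_diff by (fastforce simp: transport_def in_keys_iff lookup_minus split: if_splits)+
      then obtain e' where e': "e' \<in> Poly_Mapping.keys (pull f (insert s D) (insert s \<tau>))"
        "e = copies_exponent W (y s) + e'"
        by (auto simp: copies_product_eq keys_monomial_mult)
      have "m = e' + (z_exponent (cover (insert s D)) + copies_exponent W (x s)) + (\<Sum>t\<in>\<tau>. copies_exponent W (x t))"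
        using hp[OF e'(1)] by (simp add: sum_ins add_ac)
      also have "z_exponent (cover (insert s D)) + copies_exponent W (x s) =
          copies_exponent W (y s) + z_exponent (cover D)"
        using z_exponent_exchange[OF cd(2)] s sD by blast
      finally show ?thesis using e'(2) by (simp add: add_ac)
    qed
    then show ?thesis by (simp add: D(1) res_degree_encode[OF cd(5)])
  qed
  then show ?thesis using res_diff_mem[OF fF] by (simp add: free_component_def)
qed

lemma differential_minimal:
  assumes f: "f \<in> carrier (F (Suc p))"
  shows "differential (Suc p) f \<in> ideal_times_module R (irrelevant_ideal W) (F p)"
proof (rule mem_ideal_times_free_module)
  interpret cring R by (rule cring_mpoly_ring)
  let ?m = "irrelevant_ideal W :: ('v \<times> nat, 'k) mpoly set"
  have sub: "Var ` W \<subseteq> carrier R" using Var_closed by blast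
  have I: "ideal ?m R" unfolding irrelevant_ideal_def by (rule genideal_ideal[OF sub])
  have copies: "copies_product W v \<in> ?m" if v: "v \<in> V" for v
  proof -
    obtain j where j: "(v, j) \<in> W" using copy_in_W[OF v] by blast
    have "(copies_product W v :: ('v \<times> nat, 'k) mpoly) = Var (v, j) * (\<Prod>w\<in>{w \<in> W. fst w = v} - {(v, j)}. Var w)"
      unfolding copies_product_def using finite_W j by (intro prod.remove) auto
    moreover have "Var (v, j) \<in> ?m"
      unfolding irrelevant_ideal_def using genideal_self[OF sub] j by blast
    moreover have "(\<Prod>w\<in>{w \<in> W. fst w = v} - {(v, j)}. Var w) \<in> carrier R"
      by (intro prod_Var_closed) auto
    ultimately show ?thesis using ideal_mult_closed(2)[OF I] by simp
  qed
  have xy: "x_mono s \<in> ?m" "y_mono s \<in> ?m" if "s \<in> {1..d}" for s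
    using that copies by (auto simp: V_eq)
  note ch = chainsD(1)[OF pull_mem[OF f]]
  have tr: "transport s (pull f) D \<sigma> \<in> ?m" if s: "s \<in> {1..d}" for s D \<sigma>
  proof -
    have X: "- (x_mono s * pull f D \<sigma>) \<in> ?m"
      by (intro ideal_uminus_closed[OF I] ideal_mult_closed(2)[OF I] xy s ch)
    have Y: "y_mono s * pull f (insert s D) \<sigma> \<in> ?m"
      by (intro ideal_mult_closed(2)[OF I] xy s ch)
    show ?thesis
      using X additive_subgroup.a_closed[OF ideal.axioms(1)[OF I] Y X] by (simp add: transport_def)
  qed
  show "differential (Suc p) f c \<in> ?m" for c
  proof (cases "\<exists>D \<tau>. D \<subseteq> {1..d} \<and> \<tau> \<subseteq> {1..d} \<and> c = encode D \<tau>")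
    case True
    then obtain D \<tau> where D: "D \<subseteq> {1..d}" "\<tau> \<subseteq> {1..d}" "c = encode D \<tau>" by blast
    have "boundary (pull f) D \<tau> \<in> ?m"
      unfolding boundary_def
      by (intro ideal_sum_closed[OF I] ideal_mult_closed(1)[OF I] tr exchange_sign_closed) auto
    then show ?thesis using res_diff_encode[OF f D(1,2)] D(3) by simp
  next
    case False
    then have "differential (Suc p) f c = 0" by (intro res_diff_outside) blast
    then show ?thesis using additive_subgroup.zero_closed[OF ideal.axioms(1)[OF I]] by simp
  qed
qed (fact finite_basis res_diff_mem[OF f])+

theorem expansion_resolution: "minimal_free_resolution W basis (res_degree W) differential aug J"
  unfolding minimal_free_resolution_def Let_def
proof (intro conjI allI)
  show "aug ` free_component W (basis 0) (res_degree W) m \<subseteq> ideal_component J m" for m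
    using degree_aug by blast
  show "differential (Suc p) ` free_component W (basis (Suc p)) (res_degree W) m \<subseteq>
      free_component W (basis p) (res_degree W) m" for p m
    using degree_differential by blast
  show "differential (Suc p) ` carrier (F (Suc p)) \<subseteq> ideal_times_module R (irrelevant_ideal W) (F p)" for p
    using differential_minimal by blast
qed (fact ideal_J finite_basis linear_aug linear_differential aug_image exact_at_0 exact_at_Suc)+

end

theorem theorem5p12:
  fixes V :: "'v set" and E :: "'v set set"
    and d\<^sub>0 :: nat and x y :: "nat \<Rightarrow> 'v" and n :: "nat \<Rightarrow> nat"
    and W :: "('v \<times> nat) set"
  assumes "simple_graph V E"
    and "very_well_covered V E"
    and "cohen_macaulay_graph TYPE('k::field) V E"
    and "V = x ` {1..d\<^sub>0} \<union> y ` {1..d\<^sub>0}" and "card V = 2 * d\<^sub>0"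
    and "x ` {1..d\<^sub>0} \<in> Min_covers V E"
    and "maximal_independent_set V E (y ` {1..d\<^sub>0})"
    and "\<forall>i \<in> {1..d\<^sub>0}. {x i, y i} \<in> E"
    and "\<forall>i \<in> {1..d\<^sub>0}. \<forall>j \<in> {1..d\<^sub>0}. {x i, y j} \<in> E \<longrightarrow> i \<le> j"
    and "\<forall>i \<in> {1..d\<^sub>0}. n i > 0"
    and "W = expansion_vertices d\<^sub>0 x y n"
  shows "minimal_free_resolution W
           (res_basis V E d\<^sub>0 x y) (res_degree W)
           (res_diff V E W d\<^sub>0 x y) (res_aug V E W d\<^sub>0 x y)
           (cover_ideal W (expansion_edges W E) :: ('v \<times> nat, 'k) mpoly set)"
proof -
  interpret expanded_very_well_covered V E d\<^sub>0 x y n W "TYPE('k)"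
  proof
    show "independent_set V E (y ` {1..d\<^sub>0})" using assms(7) by (simp add: maximal_independent_set_def)
    show "i \<le> j" if "i \<in> {1..d\<^sub>0}" "j \<in> {1..d\<^sub>0}" "{x i, y j} \<in> E" for i j
      using assms(9) that by blast
  qed (use assms in \<open>simp_all del: atLeastAtMost_iff\<close>)
  show ?thesis by (rule expansion_resolution)
qed

end
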